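(* Let ${\cal A}$ be a (possibly infinite) set of agents and ${\cal G}$ a set of nonempty subsets of ${\cal A}$. For formulas in the language ${\cal L}^C_{\cal G}$ (a formula is a theorem of an axiom system iff it is valid in the corresponding class): (a) ${\rm K}^C_{\cal G}$ is a sound and complete axiomatization with respect to ${\cal M}_{\cal A}$; (b) ${\rm T}^C_{\cal G}$ is a sound and complete axiomatization with respect to ${\cal M}^r_{\cal A}$; (c) ${\rm S4}^C_{\cal G}$ is a sound and complete axiomatization with respect to ${\cal M}^{rt}_{\cal A}$; (d) ${\rm S5}^C_{\cal G}$ is a sound and complete axiomatization with respect to ${\cal M}^{rst}_{\cal A}$; (e) ${\rm KD45}^C_{\cal G}$ is a sound and complete axiomatization with respect to ${\cal M}^{elt}_{\cal A}$.
   Context: Fix a set $\Phi$ of primitive propositions. ${\cal L}^C_{\cal G}$ is the smallest set of formulas containing $\Phi$ and closed under $\wedge$, $\neg$, and the modal operators $K_i$ ($i\in{\cal A}$), $E_G$ and $C_G$ ($G\in{\cal G}$). A Kripke structure over ${\cal A}$ is $M=(S,\pi,\{{\cal K}_i:i\in{\cal A}\})$ with $S$ a set of states, $\pi(s)$ a truth assignment to $\Phi$ for each $s\in S$, and ${\cal K}_i\subseteq S\times S$. Truth is defined as usual for primitive propositions, $\wedge$, $\neg$; $(M,s)\models K_i\phi$ iff $(M,t)\models\phi$ for all $t$ with $(s,t)\in{\cal K}_i$; $(M,s)\models E_G\phi$ iff $(M,s)\models K_i\phi$ for all $i\in G$; $(M,s)\models C_G\phi$ iff $(M,s)\models E_G^k\phi$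 for all $k\ge 1$, where $E_G^1\phi=E_G\phi$ and $E_G^{k+1}\phi=E_GE_G^k\phi$. ${\cal M}_{\cal A}$ is the class of all Kripke structures over ${\cal A}$; ${\cal M}^r_{\cal A}$, ${\cal M}^{rt}_{\cal A}$, ${\cal M}^{rst}_{\cal A}$, ${\cal M}^{elt}_{\cal A}$ are the subclasses in which every ${\cal K}_i$ is respectively reflexive; reflexive and transitive; reflexive, symmetric and transitive; Euclidean (if $(s,t),(s,u)\in{\cal K}_i$ then $(t,u)\in{\cal K}_i$), serial and transitive. A formula is valid in a class if true at every state of every structure in the class. Axioms and rules (for all $i\in{\cal A}$, $G\in{\cal G}$, formulas $\phi,\psi$): Prop: all substitution instances of propositional tautologies; K1: $(K_i\phi\wedge K_i(\phi\Rightarrow\psi))\Rightarrow K_i\psi$; K2: $K_i\phi\Rightarrow\phi$; K3: $\neg K_i\,false$; K4: $K_i\phi\Rightarrow K_iK_i\phi$; K5: $\neg K_i\phi\Rightarrow K_i\neg K_i\phi$; MP: from $\phi$ and $\phi\Rightarrow\psi$ infer $\psi$; KGen: from $\phi$ infer $K_i\phi$; E1: $E_G\phi\Rightarrow K_i\phi$ if $i\in G$; E2: $(\bigwedge_{i\in{\cal A}'}K_i\phi\wedge\bigwedge_{G'\in{\cal G}'}E_{G'}\phi)\Rightarrow E_G\phi$ whenever ${\cal A}'$ is a finite subset of ${\cal A}$, ${\cal G}'$ a finite subset of ${\cal G}$, and $G\subseteq{\cal A}'\cup\bigcup{\cal G}'$; E3: $(E_G\phi\wedge E_G(\phi\Rightarrow\psi))\Rightarrow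 E_G\psi$; E4: $E_G(E_G\phi\Rightarrow\phi)$; E6: $\neg\phi\Rightarrow E_G\neg E_G\phi$; EGen: from $\phi$ infer $E_G\phi$; C1: $C_G\phi\Rightarrow E_G(\phi\wedge C_G\phi)$; RC1: from $\phi\Rightarrow E_G(\psi\wedge\phi)$ infer $\phi\Rightarrow C_G\psi$. ${\rm K}^C_{\cal G}$ consists of Prop, K1, MP, KGen, E1, E2, E3, EGen, C1, RC1. ${\rm T}^C_{\cal G}$ is ${\rm K}^C_{\cal G}$ plus K2. ${\rm S4}^C_{\cal G}$ is ${\rm K}^C_{\cal G}$ plus K2 and K4. ${\rm S5}^C_{\cal G}$ is ${\rm K}^C_{\cal G}$ plus K2, K4, K5 and E6. ${\rm KD45}^C_{\cal G}$ is ${\rm K}^C_{\cal G}$ plus K3, K4, K5 and E4. *)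

theory Defs
  imports Main
begin

datatype ('p, 'a) fm =
    Pro 'p
  | Neg "('p, 'a) fm" ("\<^bold>\<not> _" [70] 70)
  | Conj "('p, 'a) fm" "('p, 'a) fm" (infixr "\<^bold>\<and>" 65)
  | K 'a "('p, 'a) fm"
  | E "'a set" "('p, 'a) fm"
  | C "'a set" "('p, 'a) fm"

abbreviation Imp :: "('p, 'a) fm \<Rightarrow> ('p, 'a) fm \<Rightarrow> ('p, 'a) fm" (infixr "\<^bold>\<longrightarrow>" 55) where
  "\<phi> \<^bold>\<longrightarrow> \<psi> \<equiv> \<^bold>\<not> (\<phi> \<^bold>\<and> \<^bold>\<not> \<psi>)"

text \<open>The language has no propositional constants; false abbreviates a contradiction
  built from a primitive proposition.\<close>

abbreviation Fls :: "'p \<Rightarrow> ('p, 'a) fm" where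
  "Fls p \<equiv> Pro p \<^bold>\<and> \<^bold>\<not> Pro p"

text \<open>Conjunction of a nonempty list. The value at the empty list is left unspecified: the only
  use, in axiom E2 below, has a nonempty list because groups are nonempty.\<close>

fun bigconj :: "('p, 'a) fm list \<Rightarrow> ('p, 'a) fm" where
  "bigconj [\<phi>] = \<phi>"
| "bigconj (\<phi> # \<psi> # \<chi>s) = \<phi> \<^bold>\<and> bigconj (\<psi> # \<chi>s)"

inductive_set lang :: "'p set \<Rightarrow> 'a set \<Rightarrow> 'a set set \<Rightarrow> ('p, 'a) fm set"
  for \<Phi> :: "'p set" and A :: "'a set" and \<G> :: "'a set set" where
  Pro: "p \<in> \<Phi> \<Longrightarrow> Pro p \<in> lang \<Phi> A \<G>"
| Neg: "\<phi> \<in> lang \<Phi> A \<G> \<Longrightarrow> \<^bold>\<not> \<phi> \<in> lang \<Phi> A \<G>"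
| Conj: "\<phi> \<in> lang \<Phi> A \<G> \<Longrightarrow> \<psi> \<in> lang \<Phi> A \<G> \<Longrightarrow> \<phi> \<^bold>\<and> \<psi> \<in> lang \<Phi> A \<G>"
| K: "i \<in> A \<Longrightarrow> \<phi> \<in> lang \<Phi> A \<G> \<Longrightarrow> K i \<phi> \<in> lang \<Phi> A \<G>"
| E: "G \<in> \<G> \<Longrightarrow> \<phi> \<in> lang \<Phi> A \<G> \<Longrightarrow> E G \<phi> \<in> lang \<Phi> A \<G>"
| C: "G \<in> \<G> \<Longrightarrow> \<phi> \<in> lang \<Phi> A \<G> \<Longrightarrow> C G \<phi> \<in> lang \<Phi> A \<G>"


section \<open>Kripke structures\<close>

record ('s, 'p, 'a) kripke =
  states :: "'s set"
  val :: "'s \<Rightarrow> 'p \<Rightarrow> bool"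
  acc :: "'a \<Rightarrow> ('s \<times> 's) set"

text \<open>\<open>cdepth\<close> and \<open>weight\<close> serve only to show termination of \<open>sat\<close>.\<close>

primrec cdepth :: "('p, 'a) fm \<Rightarrow> nat" where
  "cdepth (Pro p) = 0"
| "cdepth (\<^bold>\<not> \<phi>) = cdepth \<phi>"
| "cdepth (\<phi> \<^bold>\<and> \<psi>) = max (cdepth \<phi>) (cdepth \<psi>)"
| "cdepth (K i \<phi>) = cdepth \<phi>"
| "cdepth (E G \<phi>) = cdepth \<phi>"
| "cdepth (C G \<phi>) = Suc (cdepth \<phi>)"

primrec weight :: "('p, 'a) fm \<Rightarrow> nat" where
  "weight (Pro p) = 0"
| "weight (\<^bold>\<not> \<phi>) = Suc (weight \<phi>)"
| "weight (\<phi> \<^bold>\<and> \<psi>) = Suc (weight \<phi> + weight \<psi>)"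
| "weight (K i \<phi>) = Suc (weight \<phi>)"
| "weight (E G \<phi>) = Suc (Suc (weight \<phi>))"
| "weight (C G \<phi>) = Suc (weight \<phi>)"

lemma cdepth_E_pow: "cdepth ((E G ^^ k) \<phi>) = cdepth \<phi>"
  by (induction k) auto

function sat :: "('s, 'p, 'a) kripke \<Rightarrow> 's \<Rightarrow> ('p, 'a) fm \<Rightarrow> bool" where
  "sat M s (Pro p) \<longleftrightarrow> val M s p"
| "sat M s (\<^bold>\<not> \<phi>) \<longleftrightarrow> \<not> sat M s \<phi>"
| "sat M s (\<phi> \<^bold>\<and> \<psi>) \<longleftrightarrow> sat M s \<phi> \<and> sat M s \<psi>"
| "sat M s (K i \<phi>) \<longleftrightarrow> (\<forall>t. (s, t) \<in> acc M i \<longrightarrow> sat M t \<phi>)"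
| "sat M s (E G \<phi>) \<longleftrightarrow> (\<forall>i\<in>G. sat M s (K i \<phi>))"
| "sat M s (C G \<phi>) \<longleftrightarrow> (\<forall>k\<ge>1. sat M s ((E G ^^ k) \<phi>))"
  by pat_completeness auto
termination
  by (relation "measures [\<lambda>(M, s, \<phi>). cdepth \<phi>, \<lambda>(M, s, \<phi>). weight \<phi>]")
    (auto simp: cdepth_E_pow max_def)

text \<open>Classes of structures. The states are drawn from the type \<open>'s\<close>, over which the classes
  are polymorphic.\<close>

definition serial_on :: "'s set \<Rightarrow> ('s \<times> 's) set \<Rightarrow> bool" where
  "serial_on S R \<longleftrightarrow> (\<forall>s\<in>S. \<exists>t\<in>S. (s, t) \<in> R)"

definition euclidean :: "('s \<times> 's) set \<Rightarrow> bool" where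
  "euclidean R \<longleftrightarrow> (\<forall>s t u. (s, t) \<in> R \<longrightarrow> (s, u) \<in> R \<longrightarrow> (t, u) \<in> R)"

definition M_all :: "'a set \<Rightarrow> ('s, 'p, 'a) kripke set" where
  "M_all A = {M. \<forall>i\<in>A. acc M i \<subseteq> states M \<times> states M}"

definition M_r :: "'a set \<Rightarrow> ('s, 'p, 'a) kripke set" where
  "M_r A = {M \<in> M_all A. \<forall>i\<in>A. refl_on (states M) (acc M i)}"

definition M_rt :: "'a set \<Rightarrow> ('s, 'p, 'a) kripke set" where
  "M_rt A = {M \<in> M_all A. \<forall>i\<in>A. refl_on (states M) (acc M i) \<and> trans (acc M i)}"

definition M_rst :: "'a set \<Rightarrow> ('s, 'p, 'a) kripke set" where
  "M_rst A = {M \<in> M_all A. \<forall>i\<in>A. refl_on (states M) (acc M i) \<and> sym (acc M i) \<and> trans (acc M i)}"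

definition M_elt :: "'a set \<Rightarrow> ('s, 'p, 'a) kripke set" where
  "M_elt A =
    {M \<in> M_all A. \<forall>i\<in>A. euclidean (acc M i) \<and> serial_on (states M) (acc M i) \<and> trans (acc M i)}"

definition valid_in :: "('s, 'p, 'a) kripke set \<Rightarrow> ('p, 'a) fm \<Rightarrow> bool" where
  "valid_in \<M> \<phi> \<longleftrightarrow> (\<forall>M\<in>\<M>. \<forall>s\<in>states M. sat M s \<phi>)"


section \<open>Axiom systems\<close>

text \<open>Propositional formulas, over an unlimited supply of variables, for the scheme Prop.\<close>

datatype pf = PVar nat | PNeg pf | PConj pf pf

primrec peval :: "(nat \<Rightarrow> bool) \<Rightarrow> pf \<Rightarrow> bool" where
  "peval v (PVar n) \<longleftrightarrow> v n"
| "peval v (PNeg \<tau>) \<longleftrightarrow> \<not> peval v \<tau>"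
| "peval v (PConj \<tau> \<rho>) \<longleftrightarrow> peval v \<tau> \<and> peval v \<rho>"

definition tautology :: "pf \<Rightarrow> bool" where
  "tautology \<tau> \<longleftrightarrow> (\<forall>v. peval v \<tau>)"

primrec psubst :: "(nat \<Rightarrow> ('p, 'a) fm) \<Rightarrow> pf \<Rightarrow> ('p, 'a) fm" where
  "psubst \<sigma> (PVar n) = \<sigma> n"
| "psubst \<sigma> (PNeg \<tau>) = \<^bold>\<not> psubst \<sigma> \<tau>"
| "psubst \<sigma> (PConj \<tau> \<rho>) = psubst \<sigma> \<tau> \<^bold>\<and> psubst \<sigma> \<rho>"

context
  fixes \<Phi> :: "'p set" and A :: "'a set" and \<G> :: "'a set set"
begin

abbreviation (input) "\<L> \<equiv> lang \<Phi> A \<G>"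

definition Prop :: "('p, 'a) fm set" where
  "Prop = {psubst \<sigma> \<tau> | \<sigma> \<tau>. tautology \<tau> \<and> psubst \<sigma> \<tau> \<in> \<L>}"

definition K1 :: "('p, 'a) fm set" where
  "K1 = {K i \<phi> \<^bold>\<and> K i (\<phi> \<^bold>\<longrightarrow> \<psi>) \<^bold>\<longrightarrow> K i \<psi> | i \<phi> \<psi>. i \<in> A \<and> \<phi> \<in> \<L> \<and> \<psi> \<in> \<L>}"

definition K2 :: "('p, 'a) fm set" where
  "K2 = {K i \<phi> \<^bold>\<longrightarrow> \<phi> | i \<phi>. i \<in> A \<and> \<phi> \<in> \<L>}"

definition K3 :: "('p, 'a) fm set" where
  "K3 = {\<^bold>\<not> K i (Fls p) | i p. i \<in> A \<and> p \<in> \<Phi>}"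

definition K4 :: "('p, 'a) fm set" where
  "K4 = {K i \<phi> \<^bold>\<longrightarrow> K i (K i \<phi>) | i \<phi>. i \<in> A \<and> \<phi> \<in> \<L>}"

definition K5 :: "('p, 'a) fm set" where
  "K5 = {\<^bold>\<not> K i \<phi> \<^bold>\<longrightarrow> K i (\<^bold>\<not> K i \<phi>) | i \<phi>. i \<in> A \<and> \<phi> \<in> \<L>}"

definition E1 :: "('p, 'a) fm set" where
  "E1 = {E G \<phi> \<^bold>\<longrightarrow> K i \<phi> | G i \<phi>. G \<in> \<G> \<and> i \<in> A \<and> i \<in> G \<and> \<phi> \<in> \<L>}"

text \<open>The finite sets of agents and groups in E2 are enumerated by lists, since
  conjunction is binary.\<close>

definition E2 :: "('p, 'a) fm set" where
  "E2 = {bigconj (map (\<lambda>i. K i \<phi>) js @ map (\<lambda>G'. E G' \<phi>) Gs) \<^bold>\<longrightarrow> E G \<phi> | js Gs G \<phi>.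
          set js \<subseteq> A \<and> set Gs \<subseteq> \<G> \<and> G \<in> \<G> \<and> G \<subseteq> set js \<union> \<Union> (set Gs) \<and> \<phi> \<in> \<L>}"

definition E3 :: "('p, 'a) fm set" where
  "E3 = {E G \<phi> \<^bold>\<and> E G (\<phi> \<^bold>\<longrightarrow> \<psi>) \<^bold>\<longrightarrow> E G \<psi> | G \<phi> \<psi>. G \<in> \<G> \<and> \<phi> \<in> \<L> \<and> \<psi> \<in> \<L>}"

definition E4 :: "('p, 'a) fm set" where
  "E4 = {E G (E G \<phi> \<^bold>\<longrightarrow> \<phi>) | G \<phi>. G \<in> \<G> \<and> \<phi> \<in> \<L>}"

definition E6 :: "('p, 'a) fm set" where
  "E6 = {\<^bold>\<not> \<phi> \<^bold>\<longrightarrow> E G (\<^bold>\<not> E G \<phi>) | G \<phi>. G \<in> \<G> \<and> \<phi> \<in> \<L>}"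

definition C1 :: "('p, 'a) fm set" where
  "C1 = {C G \<phi> \<^bold>\<longrightarrow> E G (\<phi> \<^bold>\<and> C G \<phi>) | G \<phi>. G \<in> \<G> \<and> \<phi> \<in> \<L>}"

text \<open>Theorems from a set of axioms under the inference rules common to all the systems.\<close>

inductive_set theorems :: "('p, 'a) fm set \<Rightarrow> ('p, 'a) fm set"
  for Ax :: "('p, 'a) fm set" where
  Ax: "\<phi> \<in> Ax \<Longrightarrow> \<phi> \<in> theorems Ax"
| MP: "\<phi> \<in> theorems Ax \<Longrightarrow> \<phi> \<^bold>\<longrightarrow> \<psi> \<in> theorems Ax \<Longrightarrow> \<psi> \<in> theorems Ax"
| KGen: "\<phi> \<in> theorems Ax \<Longrightarrow> i \<in> A \<Longrightarrow> K i \<phi> \<in> theorems Ax"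
| EGen: "\<phi> \<in> theorems Ax \<Longrightarrow> G \<in> \<G> \<Longrightarrow> E G \<phi> \<in> theorems Ax"
| RC1: "\<phi> \<^bold>\<longrightarrow> E G (\<psi> \<^bold>\<and> \<phi>) \<in> theorems Ax \<Longrightarrow> G \<in> \<G> \<Longrightarrow> \<phi> \<^bold>\<longrightarrow> C G \<psi> \<in> theorems Ax"

definition K_axioms :: "('p, 'a) fm set" where
  "K_axioms = Prop \<union> K1 \<union> E1 \<union> E2 \<union> E3 \<union> C1"

definition K_sys :: "('p, 'a) fm set" where
  "K_sys = theorems K_axioms"

definition T_sys :: "('p, 'a) fm set" where
  "T_sys = theorems (K_axioms \<union> K2)"

definition S4_sys :: "('p, 'a) fm set" where
  "S4_sys = theorems (K_axioms \<union> K2 \<union> K4)"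

definition S5_sys :: "('p, 'a) fm set" where
  "S5_sys = theorems (K_axioms \<union> K2 \<union> K4 \<union> K5 \<union> E6)"

definition KD45_sys :: "('p, 'a) fm set" where
  "KD45_sys = theorems (K_axioms \<union> K3 \<union> K4 \<union> K5 \<union> E4)"

end

definition sound :: "('p, 'a) fm set \<Rightarrow> ('p, 'a) fm set \<Rightarrow> ('s, 'p, 'a) kripke set \<Rightarrow> bool" where
  "sound L Th \<M> \<longleftrightarrow> (\<forall>\<phi>\<in>L. \<phi> \<in> Th \<longrightarrow> valid_in \<M> \<phi>)"

definition complete :: "('p, 'a) fm set \<Rightarrow> ('p, 'a) fm set \<Rightarrow> ('s, 'p, 'a) kripke set \<Rightarrow> bool" where
  "complete L Th \<M> \<longleftrightarrow> (\<forall>\<phi>\<in>L. valid_in \<M> \<phi> \<longrightarrow> \<phi> \<in> Th)"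

text \<open>HOL cannot quantify over types inside a formula, so the class of all structures has to be
  relativised to a type of states. Soundness is to be claimed for an arbitrary state type, and
  completeness for the following one: validity over all state types implies validity over it.\<close>

type_synonym ('p, 'a) fm_state = "('p, 'a) fm set"

end

theory Submission
  imports Defs
begin

text \<open>For completeness, a formula that is not a theorem is refuted in a finite structure of traces of
  maximal consistent sets. The agents named in the formula, and those sharing their memberships in
  its groups with only finitely many agents, get the filtered canonical relations. Every other agent
  belongs to an infinite supply of indistinguishable agents, so each edge required by a false
  \<open>E G \<psi>\<close> is given to an agent of its own, whose relation adds little else to that edge. This is why
  transitivity, symmetry and the Euclidean property need no axioms for \<open>E G\<close> beyond E4 and E6: for
  S5 the edge can be reversed by E6, and for KD45 its target is made reflexive by E4.\<close>

section \<open>Soundness\<close>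

text \<open>The obstacle is an infinite group \<open>G\<close>. E2 mentions only finitely many
  agents and groups, so for primitive \<open>p\<close> the formula \<open>Neg (E G p)\<close> is
  consistent with all the formulas \<open>K i p\<close> for \<open>i\<close> in \<open>G\<close>. In
  a canonical structure over maximal consistent sets such a false \<open>E G p\<close> would have no
  witness edge. The way out is that no \<open>K i\<close> formula of an unnamed agent occurs in the
  finite set \<open>F\<close>: its relation has to respect only the groups it belongs to and may
  contain an edge that the \<open>K i\<close> formulas of the maximal consistent set forbid.
  Finiteness of the structure serves twice. RC1 needs an invariant that is a single formula, which
  exists because a property of traces on a finite set is definable. And only finitely many edges are
  ever prescribed, so an infinite stock of indistinguishable agents has a separate one for each.
  Agents whose stock is finite cannot play this part; there are finitely many of them, so they can
  be named as well and handed to E2 individually.\<close>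

lemma lang_iffs [simp]:
  "Pro p \<in> lang \<Phi> A \<G> \<longleftrightarrow> p \<in> \<Phi>"
  "\<^bold>\<not> \<phi> \<in> lang \<Phi> A \<G> \<longleftrightarrow> \<phi> \<in> lang \<Phi> A \<G>"
  "\<phi> \<^bold>\<and> \<psi> \<in> lang \<Phi> A \<G> \<longleftrightarrow> \<phi> \<in> lang \<Phi> A \<G> \<and> \<psi> \<in> lang \<Phi> A \<G>"
  "K i \<phi> \<in> lang \<Phi> A \<G> \<longleftrightarrow> i \<in> A \<and> \<phi> \<in> lang \<Phi> A \<G>"
  "E G \<phi> \<in> lang \<Phi> A \<G> \<longleftrightarrow> G \<in> \<G> \<and> \<phi> \<in> lang \<Phi> A \<G>"
  "C G \<phi> \<in> lang \<Phi> A \<G> \<longleftrightarrow> G \<in> \<G> \<and> \<phi> \<in> lang \<Phi> A \<G>"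
  by (auto elim: lang.cases intro: lang.intros)

lemma bigconj_in_lang: "xs \<noteq> [] \<Longrightarrow> bigconj xs \<in> lang \<Phi> A \<G> \<longleftrightarrow> set xs \<subseteq> lang \<Phi> A \<G>"
  by (induction xs rule: bigconj.induct) auto

lemma sat_bigconj: "xs \<noteq> [] \<Longrightarrow> sat M s (bigconj xs) \<longleftrightarrow> (\<forall>x\<in>set xs. sat M s x)"
  by (induction xs rule: bigconj.induct) auto

lemma sat_psubst: "sat M s (psubst \<sigma> \<tau>) \<longleftrightarrow> peval (\<lambda>n. sat M s (\<sigma> n)) \<tau>"
  by (induction \<tau>) auto

section \<open>Iterated and common knowledge as truth along paths\<close>

lemma sat_E_pow:
  "sat M s ((E G ^^ k) \<phi>) \<longleftrightarrow> (\<forall>t. (s, t) \<in> (\<Union>i\<in>G. acc M i) ^^ k \<longrightarrow> sat M t \<phi>)"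
proof (induction k arbitrary: s)
  case (Suc k)
  have "(\<Union>i\<in>G. acc M i) ^^ Suc k = (\<Union>i\<in>G. acc M i) O (\<Union>i\<in>G. acc M i) ^^ k"
    by (simp add: relpow_commute)
  then show ?case by (simp only: funpow.simps o_def sat.simps Suc) blast
qed simp

text \<open>The paths are nonempty because \<open>k\<close> starts at 1: \<open>C G\<close> is the
  box of the transitive closure, not of the reflexive one.\<close>

lemma sat_C:
  "sat M s (C G \<phi>) \<longleftrightarrow> (\<forall>t. (s, t) \<in> (\<Union>i\<in>G. acc M i)\<^sup>+ \<longrightarrow> sat M t \<phi>)"
  by (auto simp: sat_E_pow trancl_power Suc_le_eq simp del: sat.simps(5))

text \<open>The fixed-point reading of \<open>C G\<close>: a nonempty path is one edge followed by
  an empty or a nonempty path. It validates C1 and later feeds the invariant for RC1.\<close>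

lemma sat_C_unfold:
  "sat M s (C G \<phi>) \<longleftrightarrow> (\<forall>i\<in>G. \<forall>t. (s, t) \<in> acc M i \<longrightarrow> sat M t \<phi> \<and> sat M t (C G \<phi>))"
proof
  assume "sat M s (C G \<phi>)"
  then show "\<forall>i\<in>G. \<forall>t. (s, t) \<in> acc M i \<longrightarrow> sat M t \<phi> \<and> sat M t (C G \<phi>)"
    unfolding sat_C by (meson UN_I r_into_trancl trancl_into_trancl2)
next
  assume "\<forall>i\<in>G. \<forall>t. (s, t) \<in> acc M i \<longrightarrow> sat M t \<phi> \<and> sat M t (C G \<phi>)"
  then have "sat M t \<phi>" if "(s, t) \<in> (\<Union>i\<in>G. acc M i)\<^sup>+" for t
    using tranclD [OF that] unfolding sat_C by (blast dest: rtranclD)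
  then show "sat M s (C G \<phi>)"
    unfolding sat_C by blast
qed

section \<open>Soundness of the rules and of the axioms\<close>

lemma soundness:
  assumes derivable: "\<phi> \<in> theorems A \<G> Ax"
    and groups: "\<And>G. G \<in> \<G> \<Longrightarrow> G \<subseteq> A"
    and frame: "M \<in> M_all A"
    and axioms: "\<And>\<psi> s. \<psi> \<in> Ax \<Longrightarrow> s \<in> states M \<Longrightarrow> sat M s \<psi>"
    and state: "s \<in> states M"
  shows "sat M s \<phi>"
  using derivable state
proof (induction arbitrary: s rule: theorems.induct)
  case (Ax \<phi>)
  then show ?case using axioms by blast
next
  case (KGen \<phi> i)
  then show ?case using frame by (auto simp: M_all_def)
next
  case (EGen \<phi> G)
  \<comment> \<open>\<open>M_all\<close> bounds \<open>acc M i\<close> only for \<open>i\<close> in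
    \<open>A\<close>; it is \<open>G \<subseteq> A\<close> that keeps the edges of \<open>G\<close>
    inside the states.\<close>
  have "acc M i \<subseteq> states M \<times> states M" if "i \<in> G" for i
    using frame groups [OF EGen.hyps(2)] that by (auto simp: M_all_def)
  then show ?case using EGen by auto
next
  case (RC1 \<phi> G \<psi>)
  have acc: "acc M i \<subseteq> states M \<times> states M" if "i \<in> G" for i
    using frame groups RC1.hyps that by (auto simp: M_all_def)
  \<comment> \<open>The premise of RC1 makes \<open>\<phi>\<close> invariant along the edges of
    \<open>G\<close> and \<open>\<psi>\<close> true behind each of them, so induction along a path
    reaches its endpoint.\<close>
  have edge: "t \<in> states M \<and> sat M t \<psi> \<and> sat M t \<phi>"
    if "r \<in> states M" "sat M r \<phi>" "i \<in> G" "(r, t) \<in> acc M i" for r t i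
    using RC1.IH [OF that(1)] that acc by auto
  have "t \<in> states M \<and> sat M t \<psi> \<and> sat M t \<phi>"
    if "(s, t) \<in> (\<Union>i\<in>G. acc M i)\<^sup>+" "sat M s \<phi>" for t
    using that
  proof (induction rule: trancl_induct)
    case (base t)
    then show ?case using edge [OF RC1.prems] by blast
  next
    case (step t u)
    then show ?case using edge [of t _ u] by blast
  qed
  then show ?case unfolding sat.simps(2,3) sat_C by blast
qed auto

lemma K_axioms_sound:
  assumes groups: "\<And>G. G \<in> \<G> \<Longrightarrow> G \<subseteq> A \<and> G \<noteq> {}"
    and ax: "\<psi> \<in> K_axioms \<Phi> A \<G>"
  shows "sat M s \<psi>"
proof -
  have "sat M s \<psi>" if e2: "\<psi> \<in> E2 \<Phi> A \<G>"
  proof -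
    from e2 obtain js Gs G \<phi> where \<psi>: "\<psi> = bigconj (map (\<lambda>i. K i \<phi>) js @ map (\<lambda>G'. E G' \<phi>) Gs) \<^bold>\<longrightarrow> E G \<phi>"
      and G: "G \<in> \<G>" "G \<subseteq> set js \<union> \<Union> (set Gs)"
      unfolding E2_def by blast
    \<comment> \<open>A nonempty \<open>G\<close> cannot be covered by two empty lists, so the
      unspecified value of \<open>bigconj\<close> at the empty list never enters.\<close>
    have "map (\<lambda>i. K i \<phi>) js @ map (\<lambda>G'. E G' \<phi>) Gs \<noteq> []"
      using G groups by fastforce
    then show ?thesis
      unfolding \<psi> using G(2) by (simp add: sat_bigconj ball_Un) blast
  qed
  moreover have "sat M s \<psi>" if "\<psi> \<in> C1 \<Phi> A \<G>"
    using that sat_C_unfold [of M s] by (auto simp: C1_def simp del: sat.simps(6))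
  moreover have "sat M s \<psi>" if "\<psi> \<in> Prop \<Phi> A \<G>"
    using that by (auto simp: Prop_def sat_psubst tautology_def)
  moreover have "sat M s \<psi>" if "\<psi> \<in> K1 \<Phi> A \<G> \<union> E1 \<Phi> A \<G> \<union> E3 \<Phi> A \<G>"
    using that by (auto simp: K1_def E1_def E3_def)
  ultimately show ?thesis using ax unfolding K_axioms_def by blast
qed

lemma sound_theorems:
  assumes groups: "\<And>G. G \<in> \<G> \<Longrightarrow> G \<subseteq> A \<and> G \<noteq> {}"
    and frames: "\<M> \<subseteq> M_all A"
    and axioms: "\<And>M s \<psi>. M \<in> \<M> \<Longrightarrow> s \<in> states M \<Longrightarrow> \<psi> \<in> Ax \<Longrightarrow> sat M s \<psi>"
  shows "sound L (theorems A \<G> (K_axioms \<Phi> A \<G> \<union> Ax)) \<M>"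
  unfolding sound_def valid_in_def
proof (intro ballI impI)
  fix \<phi> M s
  assume derivable: "\<phi> \<in> theorems A \<G> (K_axioms \<Phi> A \<G> \<union> Ax)"
    and M: "M \<in> \<M>" "s \<in> states M"
  have "sat M t \<psi>" if "\<psi> \<in> K_axioms \<Phi> A \<G> \<union> Ax" "t \<in> states M" for \<psi> t
    using that(1)
  proof
    assume "\<psi> \<in> K_axioms \<Phi> A \<G>"
    with groups show ?thesis by (rule K_axioms_sound)
  qed (rule axioms [OF M(1) that(2)])
  with derivable _ _ show "sat M s \<phi>"
    by (rule soundness) (use groups frames M in auto)
qed

lemma sound_K:
  assumes "\<And>G. G \<in> \<G> \<Longrightarrow> G \<subseteq> A \<and> G \<noteq> {}"
  shows "sound L (K_sys \<Phi> A \<G>) (M_all A)"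
  using sound_theorems [OF assms, of \<G> "M_all A" "{}"] by (simp add: K_sys_def)

lemma sound_T:
  fixes \<Phi> :: "'p set" and A :: "'a set"
  assumes groups: "\<And>G. G \<in> \<G> \<Longrightarrow> G \<subseteq> A \<and> G \<noteq> {}"
  shows "sound L (T_sys \<Phi> A \<G>) (M_r A :: ('s, 'p, 'a) kripke set)"
  unfolding T_sys_def
proof (rule sound_theorems [OF groups])
  fix M :: "('s, 'p, 'a) kripke" and s and \<psi> :: "('p, 'a) fm"
  assume "M \<in> M_r A" "s \<in> states M" "\<psi> \<in> K2 \<Phi> A \<G>"
  then show "sat M s \<psi>"
    by (auto simp: M_r_def K2_def refl_on_def) blast
qed (auto simp: M_r_def)

lemma sound_S4:
  fixes \<Phi> :: "'p set" and A :: "'a set"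
  assumes groups: "\<And>G. G \<in> \<G> \<Longrightarrow> G \<subseteq> A \<and> G \<noteq> {}"
  shows "sound L (S4_sys \<Phi> A \<G>) (M_rt A :: ('s, 'p, 'a) kripke set)"
  unfolding S4_sys_def Un_assoc
proof (rule sound_theorems [OF groups])
  fix M :: "('s, 'p, 'a) kripke" and s and \<psi> :: "('p, 'a) fm"
  assume M: "M \<in> M_rt A" and s: "s \<in> states M" and \<psi>: "\<psi> \<in> K2 \<Phi> A \<G> \<union> K4 \<Phi> A \<G>"
  have acc: "refl_on (states M) (acc M i)" "trans (acc M i)" if "i \<in> A" for i
    using M that by (auto simp: M_rt_def)
  have "sat M s \<psi>" if "\<psi> \<in> K2 \<Phi> A \<G>"
    using that acc(1) s by (auto simp: K2_def refl_on_def) blast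
  moreover have "sat M s \<psi>" if "\<psi> \<in> K4 \<Phi> A \<G>"
    using that acc(2) by (auto simp: K4_def) (meson transD)
  ultimately show "sat M s \<psi>" using \<psi> by blast
qed (auto simp: M_rt_def)

lemma sound_S5:
  fixes \<Phi> :: "'p set" and A :: "'a set"
  assumes groups: "\<And>G. G \<in> \<G> \<Longrightarrow> G \<subseteq> A \<and> G \<noteq> {}"
  shows "sound L (S5_sys \<Phi> A \<G>) (M_rst A :: ('s, 'p, 'a) kripke set)"
  unfolding S5_sys_def Un_assoc
proof (rule sound_theorems [OF groups])
  fix M :: "('s, 'p, 'a) kripke" and s and \<psi> :: "('p, 'a) fm"
  assume M: "M \<in> M_rst A" and s: "s \<in> states M"
    and \<psi>: "\<psi> \<in> K2 \<Phi> A \<G> \<union> (K4 \<Phi> A \<G> \<union> (K5 \<Phi> A \<G> \<union> E6 \<Phi> A \<G>))"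
  have acc: "refl_on (states M) (acc M i)" "sym (acc M i)" "trans (acc M i)" if "i \<in> A" for i
    using M that by (auto simp: M_rst_def)
  have "sat M s \<psi>" if "\<psi> \<in> K2 \<Phi> A \<G>"
    using that acc(1) s by (auto simp: K2_def refl_on_def) blast
  moreover have "sat M s \<psi>" if "\<psi> \<in> K4 \<Phi> A \<G>"
    using that acc(3) by (auto simp: K4_def) (meson transD)
  moreover have "sat M s \<psi>" if k5: "\<psi> \<in> K5 \<Phi> A \<G>"
  proof -
    from k5 obtain i \<phi> where "\<psi> = \<^bold>\<not> K i \<phi> \<^bold>\<longrightarrow> K i (\<^bold>\<not> K i \<phi>)" "i \<in> A"
      unfolding K5_def by blast
    moreover from this have "\<exists>v. (u, v) \<in> acc M i \<and> \<not> sat M v \<phi>"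
      if "(s, t) \<in> acc M i" "\<not> sat M t \<phi>" "(s, u) \<in> acc M i" for t u
      using acc(2,3) [of i] that by (meson symD transD)
    ultimately show ?thesis by (simp only: sat.simps) blast
  qed
  moreover have "sat M s \<psi>" if e6: "\<psi> \<in> E6 \<Phi> A \<G>"
  proof -
    from e6 obtain G \<phi> where "\<psi> = \<^bold>\<not> \<phi> \<^bold>\<longrightarrow> E G (\<^bold>\<not> E G \<phi>)" "G \<subseteq> A"
      using groups unfolding E6_def by blast
    \<comment> \<open>An edge reversed by symmetry leads back to the state where
      \<open>\<phi>\<close> fails, which refutes \<open>E G \<phi>\<close> at the target.\<close>
    then show ?thesis using acc(2) by simp (meson subsetD symD)
  qed
  ultimately show "sat M s \<psi>" using \<psi> by blast
qed (auto simp: M_rst_def)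

lemma sound_KD45:
  fixes \<Phi> :: "'p set" and A :: "'a set"
  assumes groups: "\<And>G. G \<in> \<G> \<Longrightarrow> G \<subseteq> A \<and> G \<noteq> {}"
  shows "sound L (KD45_sys \<Phi> A \<G>) (M_elt A :: ('s, 'p, 'a) kripke set)"
  unfolding KD45_sys_def Un_assoc
proof (rule sound_theorems [OF groups])
  fix M :: "('s, 'p, 'a) kripke" and s and \<psi> :: "('p, 'a) fm"
  assume M: "M \<in> M_elt A" and s: "s \<in> states M"
    and \<psi>: "\<psi> \<in> K3 \<Phi> A \<union> (K4 \<Phi> A \<G> \<union> (K5 \<Phi> A \<G> \<union> E4 \<Phi> A \<G>))"
  have acc: "euclidean (acc M i)" "serial_on (states M) (acc M i)" "trans (acc M i)" if "i \<in> A" for i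
    using M that by (auto simp: M_elt_def)
  have "sat M s \<psi>" if "\<psi> \<in> K3 \<Phi> A"
    using that acc(2) s by (fastforce simp: K3_def serial_on_def)
  moreover have "sat M s \<psi>" if "\<psi> \<in> K4 \<Phi> A \<G>"
    using that acc(3) by (auto simp: K4_def) (meson transD)
  moreover have "sat M s \<psi>" if k5: "\<psi> \<in> K5 \<Phi> A \<G>"
  proof -
    from k5 obtain i \<phi> where "\<psi> = \<^bold>\<not> K i \<phi> \<^bold>\<longrightarrow> K i (\<^bold>\<not> K i \<phi>)" "i \<in> A"
      unfolding K5_def by blast
    moreover from this have "\<exists>v. (u, v) \<in> acc M i \<and> \<not> sat M v \<phi>"
      if "(s, t) \<in> acc M i" "\<not> sat M t \<phi>" "(s, u) \<in> acc M i" for t u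
      using acc(1) that unfolding euclidean_def by blast
    ultimately show ?thesis by (simp only: sat.simps) blast
  qed
  moreover have "sat M s \<psi>" if e4: "\<psi> \<in> E4 \<Phi> A \<G>"
  proof -
    from e4 obtain G \<phi> where "\<psi> = E G (E G \<phi> \<^bold>\<longrightarrow> \<phi>)" "G \<subseteq> A"
      using groups unfolding E4_def by blast
    \<comment> \<open>The Euclidean property applied to one edge twice makes its target reflexive
      for the same agent, so the target itself is the witness.\<close>
    moreover from this have "\<exists>j\<in>G. \<exists>u. (t, u) \<in> acc M j \<and> \<not> sat M u \<phi>"
      if "i \<in> G" "(s, t) \<in> acc M i" "\<not> sat M t \<phi>" for i t
      using acc(1) [of i] that unfolding euclidean_def by blast
    ultimately show ?thesis by (simp only: sat.simps) blast
  qed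
  ultimately show "sat M s \<psi>" using \<psi> by blast
qed (auto simp: M_elt_def)


section \<open>Maximal consistent sets\<close>

locale axiom_system =
  fixes \<Phi> :: "'p set" and A :: "'a set" and \<G> :: "'a set set" and Ax :: "('p, 'a) fm set"
  assumes groups: "G \<in> \<G> \<Longrightarrow> G \<subseteq> A \<and> G \<noteq> {}"
    and K_axioms_subset: "K_axioms \<Phi> A \<G> \<subseteq> Ax"
    and Ax_subset: "Ax \<subseteq> lang \<Phi> A \<G>"
begin

abbreviation "Lang \<equiv> lang \<Phi> A \<G>"

abbreviation "Thms \<equiv> theorems A \<G> Ax"

lemma theorems_in_lang: "\<phi> \<in> Thms \<Longrightarrow> \<phi> \<in> Lang"
proof (induction rule: theorems.induct)
  case (Ax \<phi>)
  then show ?case using Ax_subset by blast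
qed simp_all

definition "mp_closed \<Delta> \<longleftrightarrow> (\<forall>\<phi> \<psi>. \<phi> \<in> \<Delta> \<longrightarrow> \<phi> \<^bold>\<longrightarrow> \<psi> \<in> \<Delta> \<longrightarrow> \<psi> \<in> \<Delta>)"
  for \<Delta> :: "('p, 'a) fm set"

text \<open>Closed under modus ponens only: KGen, EGen and RC1 preserve theoremhood but not truth at
  a state. No notion of consistency by finite conjunctions is set up; omitting a formula takes its
  place.\<close>

definition "theory_set \<Delta> \<longleftrightarrow> Thms \<subseteq> \<Delta> \<and> \<Delta> \<subseteq> Lang \<and> mp_closed \<Delta>"

definition "mcs V \<longleftrightarrow> theory_set V \<and> (\<forall>\<phi>\<in>Lang. \<^bold>\<not> \<phi> \<in> V \<longleftrightarrow> \<phi> \<notin> V)"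

lemma theory_MP:
  assumes "theory_set \<Delta>" "\<phi> \<^bold>\<longrightarrow> \<psi> \<in> \<Delta>" "\<phi> \<in> \<Delta>"
  shows "\<psi> \<in> \<Delta>"
proof -
  have "\<forall>\<phi> \<psi>. \<phi> \<in> \<Delta> \<longrightarrow> \<phi> \<^bold>\<longrightarrow> \<psi> \<in> \<Delta> \<longrightarrow> \<psi> \<in> \<Delta>"
    using assms(1) unfolding theory_set_def mp_closed_def by (elim conjE)
  from this [rule_format, OF assms(3,2)] show ?thesis .
qed

lemma theory_setI:
  assumes "Thms \<subseteq> \<Delta>" "\<Delta> \<subseteq> Lang" "\<And>\<phi> \<psi>. \<phi> \<in> \<Delta> \<Longrightarrow> \<phi> \<^bold>\<longrightarrow> \<psi> \<in> \<Delta> \<Longrightarrow> \<psi> \<in> \<Delta>"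
  shows "theory_set \<Delta>"
  unfolding theory_set_def mp_closed_def
  by (intro conjI allI impI assms(1,2)) (erule assms(3))

lemma theory_in_lang: "theory_set \<Delta> \<Longrightarrow> \<phi> \<in> \<Delta> \<Longrightarrow> \<phi> \<in> Lang"
  unfolding theory_set_def by blast

lemma theory_theorem: "theory_set \<Delta> \<Longrightarrow> \<phi> \<in> Thms \<Longrightarrow> \<phi> \<in> \<Delta>"
  unfolding theory_set_def by blast

lemma theory_axiom: "theory_set \<Delta> \<Longrightarrow> \<phi> \<in> Ax \<Longrightarrow> \<phi> \<in> \<Delta>"
  by (rule theory_theorem [OF _ theorems.Ax])

lemma theory_K_axiom: "theory_set \<Delta> \<Longrightarrow> \<phi> \<in> K_axioms \<Phi> A \<G> \<Longrightarrow> \<phi> \<in> \<Delta>"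
  using K_axioms_subset by (blast intro: theory_axiom)

abbreviation (input) "PImp \<tau> \<rho> \<equiv> PNeg (PConj \<tau> (PNeg \<rho>))"

abbreviation (input) "three \<phi> \<psi> \<chi> \<equiv> \<lambda>n::nat. if n = 0 then \<phi> else if n = 1 then \<psi> else \<chi>"

lemma tautology_in_theory:
  assumes "theory_set \<Delta>" "tautology \<tau>" "psubst \<sigma> \<tau> \<in> Lang"
  shows "psubst \<sigma> \<tau> \<in> \<Delta>"
proof -
  have "psubst \<sigma> \<tau> \<in> Prop \<Phi> A \<G>"
    using assms unfolding Prop_def by blast
  then show ?thesis
    using theory_K_axiom [OF assms(1)] unfolding K_axioms_def by blast
qed

lemma tautologies:
  assumes \<Delta>: "theory_set \<Delta>" and lang: "\<phi> \<in> Lang" "\<psi> \<in> Lang" "\<chi> \<in> Lang"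
  shows taut_refl: "\<phi> \<^bold>\<longrightarrow> \<phi> \<in> \<Delta>"
    and taut_weaken: "\<phi> \<^bold>\<longrightarrow> (\<psi> \<^bold>\<longrightarrow> \<phi>) \<in> \<Delta>"
    and taut_distrib: "(\<phi> \<^bold>\<longrightarrow> (\<psi> \<^bold>\<longrightarrow> \<chi>)) \<^bold>\<longrightarrow> ((\<phi> \<^bold>\<longrightarrow> \<psi>) \<^bold>\<longrightarrow> (\<phi> \<^bold>\<longrightarrow> \<chi>)) \<in> \<Delta>"
    and taut_contra: "\<phi> \<^bold>\<longrightarrow> (\<^bold>\<not> \<phi> \<^bold>\<longrightarrow> \<psi>) \<in> \<Delta>"
    and taut_cases: "(\<phi> \<^bold>\<longrightarrow> \<psi>) \<^bold>\<longrightarrow> ((\<^bold>\<not> \<phi> \<^bold>\<longrightarrow> \<psi>) \<^bold>\<longrightarrow> \<psi>) \<in> \<Delta>"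
    and taut_conj1: "\<phi> \<^bold>\<and> \<psi> \<^bold>\<longrightarrow> \<phi> \<in> \<Delta>"
    and taut_conj2: "\<phi> \<^bold>\<and> \<psi> \<^bold>\<longrightarrow> \<psi> \<in> \<Delta>"
    and taut_conjI: "\<phi> \<^bold>\<longrightarrow> (\<psi> \<^bold>\<longrightarrow> \<phi> \<^bold>\<and> \<psi>) \<in> \<Delta>"
proof -
  let ?a = "PVar 0" and ?b = "PVar 1" and ?c = "PVar 2"
  have *: "psubst (three \<phi> \<psi> \<chi>) \<tau> \<in> \<Delta>" if "tautology \<tau>" for \<tau>
  proof (rule tautology_in_theory [OF \<Delta> that])
    show "psubst (three \<phi> \<psi> \<chi>) \<tau> \<in> Lang"
      using lang by (induction \<tau>) auto
  qed
  show "\<phi> \<^bold>\<longrightarrow> \<phi> \<in> \<Delta>"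
    using * [of "PImp ?a ?a"] by (simp add: tautology_def)
  show "\<phi> \<^bold>\<longrightarrow> (\<psi> \<^bold>\<longrightarrow> \<phi>) \<in> \<Delta>"
    using * [of "PImp ?a (PImp ?b ?a)"] by (simp add: tautology_def)
  show "(\<phi> \<^bold>\<longrightarrow> (\<psi> \<^bold>\<longrightarrow> \<chi>)) \<^bold>\<longrightarrow> ((\<phi> \<^bold>\<longrightarrow> \<psi>) \<^bold>\<longrightarrow> (\<phi> \<^bold>\<longrightarrow> \<chi>)) \<in> \<Delta>"
    using * [of "PImp (PImp ?a (PImp ?b ?c)) (PImp (PImp ?a ?b) (PImp ?a ?c))"]
    by (simp add: tautology_def)
  show "\<phi> \<^bold>\<longrightarrow> (\<^bold>\<not> \<phi> \<^bold>\<longrightarrow> \<psi>) \<in> \<Delta>"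
    using * [of "PImp ?a (PImp (PNeg ?a) ?b)"] by (simp add: tautology_def)
  show "(\<phi> \<^bold>\<longrightarrow> \<psi>) \<^bold>\<longrightarrow> ((\<^bold>\<not> \<phi> \<^bold>\<longrightarrow> \<psi>) \<^bold>\<longrightarrow> \<psi>) \<in> \<Delta>"
    using * [of "PImp (PImp ?a ?b) (PImp (PImp (PNeg ?a) ?b) ?b)"] by (auto simp: tautology_def)
  show "\<phi> \<^bold>\<and> \<psi> \<^bold>\<longrightarrow> \<phi> \<in> \<Delta>"
    using * [of "PImp (PConj ?a ?b) ?a"] by (simp add: tautology_def)
  show "\<phi> \<^bold>\<and> \<psi> \<^bold>\<longrightarrow> \<psi> \<in> \<Delta>"
    using * [of "PImp (PConj ?a ?b) ?b"] by (simp add: tautology_def)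
  show "\<phi> \<^bold>\<longrightarrow> (\<psi> \<^bold>\<longrightarrow> \<phi> \<^bold>\<and> \<psi>) \<in> \<Delta>"
    using * [of "PImp ?a (PImp ?b (PConj ?a ?b))"] by (simp add: tautology_def)
qed

lemma theory_set_Thms: "theory_set Thms"
  by (rule theory_setI) (auto intro: theorems_in_lang theorems.MP)

text \<open>The deduction theorem in closure form: what \<open>\<phi>\<close> implies in
  \<open>\<Delta>\<close> is the theory obtained by adding \<open>\<phi>\<close>, and
  \<open>taut_distrib\<close> is its closure under modus ponens.\<close>

lemma theory_set_imp:
  assumes "theory_set \<Delta>" "\<phi> \<in> Lang"
  shows "theory_set {\<chi> \<in> Lang. \<phi> \<^bold>\<longrightarrow> \<chi> \<in> \<Delta>}" (is "theory_set ?\<Delta>")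
    and "\<Delta> \<subseteq> {\<chi> \<in> Lang. \<phi> \<^bold>\<longrightarrow> \<chi> \<in> \<Delta>}"
    and "\<phi> \<in> {\<chi> \<in> Lang. \<phi> \<^bold>\<longrightarrow> \<chi> \<in> \<Delta>}"
proof -
  show sub: "\<Delta> \<subseteq> ?\<Delta>"
  proof
    fix \<chi> assume \<chi>: "\<chi> \<in> \<Delta>"
    then have "\<chi> \<in> Lang" by (rule theory_in_lang [OF assms(1)])
    then show "\<chi> \<in> ?\<Delta>"
      using theory_MP [OF assms(1) taut_weaken \<chi>] assms by blast
  qed
  show "\<phi> \<in> ?\<Delta>"
    using assms taut_refl by blast
  have "\<psi> \<in> ?\<Delta>" if "\<chi> \<in> ?\<Delta>" "\<chi> \<^bold>\<longrightarrow> \<psi> \<in> ?\<Delta>" for \<chi> \<psi>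
  proof -
    have "\<psi> \<in> Lang" using that by simp
    moreover have "(\<phi> \<^bold>\<longrightarrow> (\<chi> \<^bold>\<longrightarrow> \<psi>)) \<^bold>\<longrightarrow> ((\<phi> \<^bold>\<longrightarrow> \<chi>) \<^bold>\<longrightarrow> (\<phi> \<^bold>\<longrightarrow> \<psi>)) \<in> \<Delta>"
      using taut_distrib assms that \<open>\<psi> \<in> Lang\<close> by blast
    ultimately show ?thesis
      using theory_MP [OF assms(1) theory_MP [OF assms(1)]] that by blast
  qed
  then show "theory_set ?\<Delta>"
    using sub theory_theorem [OF assms(1)] by (intro theory_setI) blast+
qed

text \<open>Zorn's lemma, as \<open>\<Phi>\<close> and \<open>A\<close> may be uncountable.
  Maximality is relative to omitting \<open>\<psi>\<close>: adding any \<open>\<phi>\<close> outside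
  \<open>V\<close> would produce \<open>\<psi>\<close>, so \<open>V\<close> contains the implication
  from \<open>\<phi>\<close> to \<open>\<psi>\<close>. If both \<open>\<phi>\<close> and its
  negation were outside, \<open>taut_cases\<close> would put \<open>\<psi>\<close> into
  \<open>V\<close>.\<close>

lemma lindenbaum:
  assumes \<Delta>: "theory_set \<Delta>" and \<psi>: "\<psi> \<in> Lang" "\<psi> \<notin> \<Delta>"
  obtains V where "mcs V" "\<Delta> \<subseteq> V" "\<psi> \<notin> V"
proof -
  let ?\<A> = "{\<Gamma>. theory_set \<Gamma> \<and> \<Delta> \<subseteq> \<Gamma> \<and> \<psi> \<notin> \<Gamma>}"
  have "\<exists>V\<in>?\<A>. \<forall>X\<in>?\<A>. V \<subseteq> X \<longrightarrow> X = V"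
  proof (rule subset_Zorn_nonempty)
    show "?\<A> \<noteq> {}" using assms by blast
    fix \<C> assume \<C>: "\<C> \<noteq> {}" "subset.chain ?\<A> \<C>"
    have "\<chi> \<in> \<Union>\<C>" if "\<phi> \<in> \<Union>\<C>" "\<phi> \<^bold>\<longrightarrow> \<chi> \<in> \<Union>\<C>" for \<phi> \<chi>
    proof -
      from that obtain X Y where XY: "X \<in> \<C>" "Y \<in> \<C>" "\<phi> \<in> X" "\<phi> \<^bold>\<longrightarrow> \<chi> \<in> Y" by blast
      then have "X \<subseteq> Y \<or> Y \<subseteq> X"
        using \<C>(2) by (auto simp: subset_chain_def)
      then obtain Z where "Z \<in> \<C>" "\<phi> \<in> Z" "\<phi> \<^bold>\<longrightarrow> \<chi> \<in> Z" using XY by blast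
      moreover have "theory_set Z" using \<C>(2) \<open>Z \<in> \<C>\<close> by (auto simp: subset_chain_def)
      ultimately show ?thesis using theory_MP [of Z \<phi> \<chi>] by blast
    qed
    moreover have "Thms \<subseteq> \<Union>\<C>" "\<Union>\<C> \<subseteq> Lang" "\<Delta> \<subseteq> \<Union>\<C>" "\<psi> \<notin> \<Union>\<C>"
      using \<C> unfolding subset_chain_def theory_set_def by blast+
    ultimately show "\<Union>\<C> \<in> ?\<A>"
      using theory_setI [of "\<Union>\<C>"] by blast
  qed
  then obtain V where "V \<in> ?\<A>" and max: "\<forall>X\<in>?\<A>. V \<subseteq> X \<longrightarrow> X = V" ..
  then have V: "theory_set V" "\<Delta> \<subseteq> V" "\<psi> \<notin> V" by simp_all
  have imp: "\<phi> \<^bold>\<longrightarrow> \<psi> \<in> V" if "\<phi> \<in> Lang" "\<phi> \<notin> V" for \<phi>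
  proof (rule ccontr)
    let ?X = "{\<chi> \<in> Lang. \<phi> \<^bold>\<longrightarrow> \<chi> \<in> V}"
    assume "\<phi> \<^bold>\<longrightarrow> \<psi> \<notin> V"
    then have "?X \<in> ?\<A>"
      using theory_set_imp [OF V(1) that(1)] V(2) by blast
    then have "?X = V"
      using max theory_set_imp(2) [OF V(1) that(1)] by blast
    then show False
      using theory_set_imp(3) [OF V(1) that(1)] that(2) by blast
  qed
  have "\<^bold>\<not> \<phi> \<in> V \<longleftrightarrow> \<phi> \<notin> V" if \<phi>: "\<phi> \<in> Lang" for \<phi>
  proof
    assume "\<^bold>\<not> \<phi> \<in> V"
    then show "\<phi> \<notin> V"
      using theory_MP [OF V(1) theory_MP [OF V(1) taut_contra [OF V(1) \<phi> \<psi>(1) \<psi>(1)]]] V(3) by blast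
  next
    assume "\<phi> \<notin> V"
    then show "\<^bold>\<not> \<phi> \<in> V"
      using theory_MP [OF V(1) theory_MP [OF V(1) taut_cases [OF V(1) \<phi> \<psi>(1) \<psi>(1)] imp [OF \<phi>]]]
        imp [of "\<^bold>\<not> \<phi>"] \<phi> V(3) by auto
  qed
  then show ?thesis
    using that V unfolding mcs_def by blast
qed

lemma mcs_theory: "mcs V \<Longrightarrow> theory_set V"
  by (simp add: mcs_def)

lemma mcs_in_lang: "mcs V \<Longrightarrow> \<phi> \<in> V \<Longrightarrow> \<phi> \<in> Lang"
  by (rule theory_in_lang [OF mcs_theory])

lemma mcs_MP: "mcs V \<Longrightarrow> \<phi> \<^bold>\<longrightarrow> \<psi> \<in> V \<Longrightarrow> \<phi> \<in> V \<Longrightarrow> \<psi> \<in> V"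
  by (rule theory_MP [OF mcs_theory])

lemma mcs_Neg: "mcs V \<Longrightarrow> \<phi> \<in> Lang \<Longrightarrow> \<^bold>\<not> \<phi> \<in> V \<longleftrightarrow> \<phi> \<notin> V"
  by (simp add: mcs_def)

lemma mcs_Conj: "mcs V \<Longrightarrow> \<phi> \<^bold>\<and> \<psi> \<in> V \<longleftrightarrow> \<phi> \<in> V \<and> \<psi> \<in> V"
proof -
  assume "mcs V"
  then have V: "theory_set V" by (rule mcs_theory)
  show ?thesis
  proof
    assume conj: "\<phi> \<^bold>\<and> \<psi> \<in> V"
    have lang: "\<phi> \<in> Lang" "\<psi> \<in> Lang" using theory_in_lang [OF V conj] by auto
    show "\<phi> \<in> V \<and> \<psi> \<in> V"
      using theory_MP [OF V taut_conj1 [OF V lang lang(1)] conj]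
        theory_MP [OF V taut_conj2 [OF V lang lang(1)] conj] ..
  next
    assume conj: "\<phi> \<in> V \<and> \<psi> \<in> V"
    then have lang: "\<phi> \<in> Lang" "\<psi> \<in> Lang" using theory_in_lang [OF V] by blast+
    show "\<phi> \<^bold>\<and> \<psi> \<in> V"
      using theory_MP [OF V theory_MP [OF V taut_conjI [OF V lang lang(1)]]] conj by blast
  qed
qed

lemma mcs_bigconj: "mcs V \<Longrightarrow> xs \<noteq> [] \<Longrightarrow> bigconj xs \<in> V \<longleftrightarrow> (\<forall>x\<in>set xs. x \<in> V)"
  by (induction xs rule: bigconj.induct) (auto simp: mcs_Conj)

text \<open>Replaces derivations by membership arguments: the premises of RC1, KGen and EGen are
  later obtained by checking every maximal consistent set.\<close>

lemma theorem_iff_mcs: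
  assumes "\<phi> \<in> Lang"
  shows "\<phi> \<in> Thms \<longleftrightarrow> (\<forall>V. mcs V \<longrightarrow> \<phi> \<in> V)"
  using assms lindenbaum [OF theory_set_Thms] theory_theorem mcs_theory by metis

lemma mcs_Imp: "mcs V \<Longrightarrow> \<phi> \<in> Lang \<Longrightarrow> \<psi> \<in> Lang \<Longrightarrow> \<phi> \<^bold>\<longrightarrow> \<psi> \<in> V \<longleftrightarrow> (\<phi> \<in> V \<longrightarrow> \<psi> \<in> V)"
  by (simp add: mcs_Neg mcs_Conj)

lemma mcs_axiom_Imp: "mcs V \<Longrightarrow> \<phi> \<^bold>\<longrightarrow> \<psi> \<in> Ax \<Longrightarrow> \<phi> \<in> V \<Longrightarrow> \<psi> \<in> V"
  using mcs_MP theory_axiom [OF mcs_theory] by blast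

section \<open>Modal reasoning inside maximal consistent sets\<close>

lemma theory_set_K:
  assumes "theory_set \<Delta>" "i \<in> A"
  shows "theory_set {\<chi>. K i \<chi> \<in> \<Delta>}"
proof (rule theory_setI)
  show "Thms \<subseteq> {\<chi>. K i \<chi> \<in> \<Delta>}"
    using theory_theorem [OF assms(1) theorems.KGen [OF _ assms(2)]] by blast
  show sub: "{\<chi>. K i \<chi> \<in> \<Delta>} \<subseteq> Lang"
    by (auto dest: theory_in_lang [OF assms(1)])
  fix \<phi> \<psi> assume *: "\<phi> \<in> {\<chi>. K i \<chi> \<in> \<Delta>}" "\<phi> \<^bold>\<longrightarrow> \<psi> \<in> {\<chi>. K i \<chi> \<in> \<Delta>}"
  with sub have lang: "\<phi> \<in> Lang" "\<psi> \<in> Lang" by auto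
  then have "K i \<phi> \<^bold>\<and> K i (\<phi> \<^bold>\<longrightarrow> \<psi>) \<^bold>\<longrightarrow> K i \<psi> \<in> \<Delta>"
    using theory_K_axiom [OF assms(1)] assms(2) unfolding K_axioms_def K1_def by blast
  moreover have "K i \<phi> \<^bold>\<and> K i (\<phi> \<^bold>\<longrightarrow> \<psi>) \<in> \<Delta>"
    using theory_MP [OF assms(1) theory_MP [OF assms(1) taut_conjI [OF assms(1)]]] lang assms * by auto
  ultimately show "\<psi> \<in> {\<chi>. K i \<chi> \<in> \<Delta>}"
    using theory_MP [OF assms(1)] by blast
qed

text \<open>E3 and EGen make \<open>E G\<close> a normal box in its own right, so that
  \<open>lindenbaum\<close> applies to it without passing through the agents of
  \<open>G\<close>.\<close>

lemma theory_set_E: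
  assumes "theory_set \<Delta>" "G \<in> \<G>"
  shows "theory_set {\<chi>. E G \<chi> \<in> \<Delta>}"
proof (rule theory_setI)
  show "Thms \<subseteq> {\<chi>. E G \<chi> \<in> \<Delta>}"
    using theory_theorem [OF assms(1) theorems.EGen [OF _ assms(2)]] by blast
  show sub: "{\<chi>. E G \<chi> \<in> \<Delta>} \<subseteq> Lang"
    by (auto dest: theory_in_lang [OF assms(1)])
  fix \<phi> \<psi> assume *: "\<phi> \<in> {\<chi>. E G \<chi> \<in> \<Delta>}" "\<phi> \<^bold>\<longrightarrow> \<psi> \<in> {\<chi>. E G \<chi> \<in> \<Delta>}"
  with sub have lang: "\<phi> \<in> Lang" "\<psi> \<in> Lang" by auto
  then have "E G \<phi> \<^bold>\<and> E G (\<phi> \<^bold>\<longrightarrow> \<psi>) \<^bold>\<longrightarrow> E G \<psi> \<in> \<Delta>"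
    using theory_K_axiom [OF assms(1)] assms(2) unfolding K_axioms_def E3_def by blast
  moreover have "E G \<phi> \<^bold>\<and> E G (\<phi> \<^bold>\<longrightarrow> \<psi>) \<in> \<Delta>"
    using theory_MP [OF assms(1) theory_MP [OF assms(1) taut_conjI [OF assms(1)]]] lang assms * by auto
  ultimately show "\<psi> \<in> {\<chi>. E G \<chi> \<in> \<Delta>}"
    using theory_MP [OF assms(1)] by blast
qed

lemma mcs_E1: "mcs V \<Longrightarrow> E G \<phi> \<in> V \<Longrightarrow> i \<in> G \<Longrightarrow> K i \<phi> \<in> V"
proof -
  assume V: "mcs V" and \<phi>: "E G \<phi> \<in> V" and i: "i \<in> G"
  then have "G \<in> \<G>" "\<phi> \<in> Lang"
    using mcs_in_lang [OF V \<phi>] by auto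
  then have "E G \<phi> \<^bold>\<longrightarrow> K i \<phi> \<in> V"
    using theory_K_axiom [OF mcs_theory [OF V]] i groups unfolding K_axioms_def E1_def by blast
  then show ?thesis using mcs_MP [OF V _ \<phi>] by blast
qed

lemma mcs_E2:
  assumes V: "mcs V" and fin: "finite I" "finite \<H>" and G: "G \<in> \<G>" "G \<subseteq> I \<union> \<Union>\<H>"
    and K: "\<And>i. i \<in> I \<Longrightarrow> K i \<phi> \<in> V" and E: "\<And>H. H \<in> \<H> \<Longrightarrow> E H \<phi> \<in> V"
  shows "E G \<phi> \<in> V"
proof -
  obtain js Gs where lists: "set js = I" "set Gs = \<H>"
    using fin finite_list by metis
  let ?xs = "map (\<lambda>i. K i \<phi>) js @ map (\<lambda>G'. E G' \<phi>) Gs"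
  have lang: "K i \<phi> \<in> Lang" if "i \<in> I" for i
    using K mcs_in_lang [OF V] that by blast
  have lang': "E H \<phi> \<in> Lang" if "H \<in> \<H>" for H
    using E mcs_in_lang [OF V] that by blast
  have "I \<noteq> {} \<or> \<H> \<noteq> {}" using G groups by blast
  then have "\<phi> \<in> Lang" using lang lang' by auto
  have "?xs \<noteq> []" using \<open>I \<noteq> {} \<or> \<H> \<noteq> {}\<close> lists by auto
  then have "bigconj ?xs \<in> V"
    using K E lists by (auto simp: mcs_bigconj [OF V])
  moreover have "bigconj ?xs \<^bold>\<longrightarrow> E G \<phi> \<in> E2 \<Phi> A \<G>"
    using lang lang' G \<open>\<phi> \<in> Lang\<close> unfolding E2_def lists [symmetric]
    by (intro CollectI exI [of _ js] exI [of _ Gs] exI [of _ G] exI [of _ \<phi>] conjI refl) (auto simp: lists)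
  then have "bigconj ?xs \<^bold>\<longrightarrow> E G \<phi> \<in> V"
    using theory_K_axiom [OF mcs_theory [OF V]] unfolding K_axioms_def by blast
  ultimately show ?thesis using mcs_MP [OF V] by blast
qed

lemma mcs_C1:
  assumes V: "mcs V" and \<phi>: "C G \<phi> \<in> V"
  shows "E G (\<phi> \<^bold>\<and> C G \<phi>) \<in> V"
proof -
  have "G \<in> \<G>" "\<phi> \<in> Lang"
    using mcs_in_lang [OF V \<phi>] by auto
  then have "C G \<phi> \<^bold>\<longrightarrow> E G (\<phi> \<^bold>\<and> C G \<phi>) \<in> V"
    using theory_K_axiom [OF mcs_theory [OF V]] unfolding K_axioms_def C1_def by blast
  then show ?thesis using mcs_MP [OF V _ \<phi>] by blast
qed

text \<open>An inclusion between all maximal consistent sets is a provable implication, to which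
  KGen and K1 apply.\<close>

lemma mcs_K_mono:
  assumes "mcs V" "i \<in> A" "\<psi> \<in> Lang" "\<And>W. mcs W \<Longrightarrow> \<phi> \<in> W \<Longrightarrow> \<psi> \<in> W" "K i \<phi> \<in> V"
  shows "K i \<psi> \<in> V"
proof -
  have "\<phi> \<in> Lang" using mcs_in_lang [OF assms(1,5)] by simp
  then have "\<phi> \<^bold>\<longrightarrow> \<psi> \<in> Thms"
    using assms by (auto simp: theorem_iff_mcs mcs_Imp)
  then show ?thesis
    using theory_theorem [OF theory_set_K [OF mcs_theory [OF assms(1)] assms(2)]]
      theory_MP [OF theory_set_K [OF mcs_theory [OF assms(1)] assms(2)], of \<phi> \<psi>] assms(5) by blast
qed

lemma mcs_E_mono:
  assumes "mcs V" "\<psi> \<in> Lang" "\<And>W. mcs W \<Longrightarrow> \<phi> \<in> W \<Longrightarrow> \<psi> \<in> W" "E G \<phi> \<in> V"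
  shows "E G \<psi> \<in> V"
proof -
  have "\<phi> \<in> Lang" "G \<in> \<G>" using mcs_in_lang [OF assms(1,4)] by simp_all
  moreover from this have "\<phi> \<^bold>\<longrightarrow> \<psi> \<in> Thms"
    using assms by (auto simp: theorem_iff_mcs mcs_Imp)
  ultimately show ?thesis
    using theory_theorem [OF theory_set_E [OF mcs_theory [OF assms(1)]]]
      theory_MP [OF theory_set_E [OF mcs_theory [OF assms(1)]], of G \<phi> \<psi>] assms(4) by blast
qed

lemma K_witness:
  assumes "mcs V" "i \<in> A" "\<psi> \<in> Lang" "K i \<psi> \<notin> V"
  obtains W where "mcs W" "\<And>\<chi>. K i \<chi> \<in> V \<Longrightarrow> \<chi> \<in> W" "\<psi> \<notin> W"
proof -
  have "\<psi> \<notin> {\<chi>. K i \<chi> \<in> V}" using assms(4) by simp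
  then obtain W where "mcs W" "{\<chi>. K i \<chi> \<in> V} \<subseteq> W" "\<psi> \<notin> W"
    by (rule lindenbaum [OF theory_set_K [OF mcs_theory [OF assms(1)] assms(2)] assms(3)])
  then show thesis by (intro that [of W]) auto
qed

text \<open>Expansion as a decision tree, branching on one formula of \<open>F\<close> at a time.
  \<open>Q\<close> is an arbitrary predicate of traces: it may express a disjunction, but also truth
  in a structure under construction.\<close>

lemma definable:
  assumes "finite F" "F \<subseteq> Lang" "\<theta> \<in> Lang"
  shows "\<exists>\<phi>\<in>Lang. \<forall>V. mcs V \<longrightarrow> (\<phi> \<in> V \<longleftrightarrow> Q (V \<inter> F))"
  using assms(1,2)
proof (induction F arbitrary: Q)
  case empty
  \<comment> \<open>The language has no constants, so \<open>\<theta>\<close> supplies the true and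
    the false formula at the leaves.\<close>
  let ?\<phi> = "if Q {} then \<theta> \<^bold>\<longrightarrow> \<theta> else \<theta> \<^bold>\<and> \<^bold>\<not> \<theta>"
  have "?\<phi> \<in> V \<longleftrightarrow> Q {}" if "mcs V" for V
    using that assms(3) by (simp add: mcs_Conj mcs_Neg)
  then show ?case using assms(3) by (intro bexI [of _ ?\<phi>]) auto
next
  case (insert \<chi> F)
  obtain \<phi>1 where 1: "\<phi>1 \<in> Lang" "\<And>V. mcs V \<Longrightarrow> \<phi>1 \<in> V \<longleftrightarrow> Q (insert \<chi> (V \<inter> F))"
    using insert.IH [of "\<lambda>X. Q (insert \<chi> X)"] insert.prems by blast
  obtain \<phi>2 where 2: "\<phi>2 \<in> Lang" "\<And>V. mcs V \<Longrightarrow> \<phi>2 \<in> V \<longleftrightarrow> Q (V \<inter> F)"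
    using insert.IH [of Q] insert.prems by blast
  let ?\<phi> = "(\<chi> \<^bold>\<longrightarrow> \<phi>1) \<^bold>\<and> (\<^bold>\<not> \<chi> \<^bold>\<longrightarrow> \<phi>2)"
  have "?\<phi> \<in> V \<longleftrightarrow> Q (V \<inter> insert \<chi> F)" if "mcs V" for V
    using that 1 2 insert.prems by (cases "\<chi> \<in> V") (auto simp: mcs_Conj mcs_Neg)
  then show ?case using 1(1) 2(1) insert.prems by (intro bexI [of _ ?\<phi>]) auto
qed

text \<open>The mcs \<open>W\<close> extends the formulas that \<open>V\<close> takes to be known by everyone in \<open>G\<close>. If every
  agent \<open>i \<in> G - J\<close> had some \<open>\<chi> \<notin> W\<close> that \<open>V\<close> attributes to a group in \<open>\<H>\<close> containing \<open>i\<close>, then E2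
  would put the disjunction of \<open>\<psi>\<close> and finitely many such \<open>\<chi>\<close> into \<open>W\<close>.\<close>

lemma E_witness:
  assumes V: "mcs V" and G: "G \<in> \<G>" and \<psi>: "\<psi> \<in> Lang" "E G \<psi> \<notin> V"
    and J: "finite J" and \<H>: "finite \<H>"
    and K: "\<And>j. j \<in> J \<inter> G \<Longrightarrow> K j \<psi> \<in> V"
  obtains i W where "i \<in> G - J" "mcs W" "\<psi> \<notin> W"
    "\<And>H \<chi>. H \<in> \<H> \<Longrightarrow> i \<in> H \<Longrightarrow> E H \<chi> \<in> V \<Longrightarrow> \<chi> \<in> W"
proof (rule ccontr)
  note witness = that
  assume no_witness: "\<not> thesis"
  have "\<psi> \<notin> {\<chi>. E G \<chi> \<in> V}" using \<psi>(2) by simp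
  then obtain W where W: "mcs W" "{\<chi>. E G \<chi> \<in> V} \<subseteq> W" "\<psi> \<notin> W"
    by (rule lindenbaum [OF theory_set_E [OF mcs_theory [OF V] G] \<psi>(1)])
  define \<T> where "\<T> = {(H, \<chi>). H \<in> \<H> \<and> E H \<chi> \<in> V \<and> \<chi> \<notin> W}"
  have "\<exists>(H, \<chi>)\<in>\<T>. i \<in> H" if "i \<in> G - J" for i
    using witness [OF that W(1,3)] no_witness unfolding \<T>_def by blast
  then have cover: "G \<subseteq> (J \<inter> G) \<union> \<Union>(fst ` \<T>)" by fastforce
  have "\<exists>\<chi>. (H, \<chi>) \<in> \<T>" if "H \<in> fst ` \<T>" for H using that by fastforce
  \<comment> \<open>One formula per group is enough for the cover. The set \<open>\<T>\<close> may
    be infinite, but only finitely many groups occur in it, which is what E2 demands.\<close>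
  then obtain f where f: "\<And>H. H \<in> fst ` \<T> \<Longrightarrow> (H, f H) \<in> \<T>" by metis
  have fin: "finite (fst ` \<T>)"
    using \<H> by (rule finite_subset [rotated]) (auto simp: \<T>_def)
  define F where "F = insert \<psi> (f ` fst ` \<T>)"
  have fT: "E H (f H) \<in> V" "f H \<notin> W" if "H \<in> fst ` \<T>" for H
    using f [OF that] by (auto simp: \<T>_def)
  have "f H \<in> Lang" if "H \<in> fst ` \<T>" for H
    using mcs_in_lang [OF V fT(1) [OF that]] by simp
  then have "F \<subseteq> Lang" using \<psi>(1) by (auto simp: F_def)
  moreover have "finite F" using fin by (simp add: F_def)
  moreover have "F \<inter> W = {}" using W(3) fT(2) by (auto simp: F_def)
  ultimately obtain \<theta> where \<theta>: "\<theta> \<in> Lang" "\<And>U. mcs U \<Longrightarrow> \<theta> \<in> U \<longleftrightarrow> U \<inter> F \<noteq> {}"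
    using definable [of F \<psi> "\<lambda>X. X \<noteq> {}"] \<psi>(1) by blast
  have "E G \<theta> \<in> V"
  proof (rule mcs_E2 [OF V _ fin G cover])
    fix j assume "j \<in> J \<inter> G"
    then have "K j \<psi> \<in> V" "j \<in> A" using K groups [OF G] by auto
    then show "K j \<theta> \<in> V"
      by (intro mcs_K_mono [OF V _ \<theta>(1), of j \<psi>]) (auto simp: \<theta>(2) F_def)
  next
    fix H assume "H \<in> fst ` \<T>"
    then show "E H \<theta> \<in> V"
      using fT(1) by (intro mcs_E_mono [OF V \<theta>(1), of "f H" H]) (auto simp: \<theta>(2) F_def)
  qed (use J in simp)
  then show False using W(1,2) \<theta>(2) \<open>F \<inter> W = {}\<close> by blast
qed

end


section \<open>Finite countermodels\<close>

text \<open>Greedy choice: finitely many earlier choices cannot exhaust an infinite set. It will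
  assign each prescribed edge an agent of its own.\<close>

lemma distinct_representatives:
  assumes "finite N" "\<And>n. n \<in> N \<Longrightarrow> infinite (B n)"
  shows "\<exists>a. inj_on a N \<and> (\<forall>n\<in>N. a n \<in> B n)"
  using assms
proof (induction N)
  case (insert n N)
  then obtain a where a: "inj_on a N" "\<forall>n\<in>N. a n \<in> B n" by blast
  have "infinite (B n - a ` N)"
    using insert by (simp add: Diff_infinite_finite)
  then obtain b where "b \<in> B n - a ` N"
    by (metis ex_in_conv finite.emptyI)
  then have "inj_on (a(n := b)) (insert n N) \<and> (\<forall>k\<in>insert n N. (a(n := b)) k \<in> B k)"
    using a insert.hyps by (auto simp: inj_on_def)
  then show ?case by blast
qed simp

lemma finite_groups: "finite F \<Longrightarrow> finite {G. \<exists>\<phi>. E G \<phi> \<in> F}"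
proof (rule finite_surj)
  show "{G. \<exists>\<phi>. E G \<phi> \<in> F} \<subseteq> (\<lambda>\<phi>. case \<phi> of E G \<psi> \<Rightarrow> G | _ \<Rightarrow> {}) ` F"
    by force
qed

lemma finite_agents: "finite F \<Longrightarrow> finite {i. \<exists>\<phi>. K i \<phi> \<in> F}"
proof (rule finite_surj)
  show "{i. \<exists>\<phi>. K i \<phi> \<in> F} \<subseteq> (\<lambda>\<phi>. case \<phi> of K i \<psi> \<Rightarrow> i | _ \<Rightarrow> undefined) ` F"
    by force
qed

text \<open>States are the traces on \<open>F\<close> of mcs, each occurring twice: with and without the marker \<open>m\<close>.
  The copies matter only for KD45. The agents in \<open>J\<close> get the usual filtered accessibility
  relations; any other agent shares its memberships in the groups of \<open>F\<close> with infinitely many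
  agents, so that each of them has to provide at most one prescribed edge.\<close>

locale filtration = axiom_system \<Phi> A \<G> Ax
  for \<Phi> :: "'p set" and A :: "'a set" and \<G> Ax +
  fixes F :: "('p, 'a) fm set" and J :: "'a set" and m :: "('p, 'a) fm"
  assumes finite_F: "finite F" and F_subset: "F \<subseteq> lang \<Phi> A \<G>"
    and F_Neg: "\<^bold>\<not> \<phi> \<in> F \<Longrightarrow> \<phi> \<in> F"
    and F_Conj: "\<phi> \<^bold>\<and> \<psi> \<in> F \<Longrightarrow> \<phi> \<in> F \<and> \<psi> \<in> F"
    and F_K: "K i \<phi> \<in> F \<Longrightarrow> i \<in> J \<and> \<phi> \<in> F"
    and F_E: "E G \<phi> \<in> F \<Longrightarrow> \<phi> \<in> F"
    and F_E_K: "E G \<phi> \<in> F \<Longrightarrow> j \<in> J \<Longrightarrow> j \<in> G \<Longrightarrow> K j \<phi> \<in> F"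
    and F_C: "C G \<phi> \<in> F \<Longrightarrow> E G (\<phi> \<^bold>\<and> C G \<phi>) \<in> F"
    and finite_J: "finite J" and J_subset: "J \<subseteq> A"
    and unnamed: "i \<in> A - J \<Longrightarrow> infinite {i' \<in> A. \<forall>G \<phi>. E G \<phi> \<in> F \<longrightarrow> (i' \<in> G \<longleftrightarrow> i \<in> G)}"
    and marker: "m \<notin> F" and F_nonempty: "F \<noteq> {}"
begin

section \<open>Traces as states and the relations allowed to each agent\<close>

definition "Gr = {G. \<exists>\<phi>. E G \<phi> \<in> F}"

text \<open>The type of an agent. It alone constrains the edges of an unnamed agent, so agents of
  one type can stand in for each other.\<close>

definition "memb i = {G \<in> Gr. i \<in> G}"

text \<open>A relation and not a map: many \<open>V\<close> share a trace, and each trace has two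
  copies.\<close>

definition "rep V X \<longleftrightarrow> mcs V \<and> X \<subseteq> insert m F \<and> X \<inter> F = V \<inter> F"

definition "S = {X. \<exists>V. rep V X}"

text \<open>The two bounds that define a filtration: edges respect the \<open>K i\<close> formulas
  of \<open>F\<close>, and every canonical edge survives. The frame condition decides which relation
  between them is taken.\<close>

definition "named_rel i r \<longleftrightarrow> r \<subseteq> S \<times> S \<and>
  (\<forall>X Y \<chi>. (X, Y) \<in> r \<longrightarrow> K i \<chi> \<in> F \<longrightarrow> K i \<chi> \<in> X \<longrightarrow> \<chi> \<in> Y) \<and>
  (\<forall>V W X Y. rep V X \<longrightarrow> rep W Y \<longrightarrow> (\<forall>\<chi>. K i \<chi> \<in> V \<longrightarrow> \<chi> \<in> W) \<longrightarrow> (X, Y) \<in> r)"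

text \<open>Only the upper bound is kept: the witness edges are spread over many agents of the type,
  so each single relation may be small.\<close>

definition "group_rel T r \<longleftrightarrow> r \<subseteq> S \<times> S \<and>
  (\<forall>X Y G \<chi>. (X, Y) \<in> r \<longrightarrow> G \<in> T \<longrightarrow> E G \<chi> \<in> F \<longrightarrow> E G \<chi> \<in> X \<longrightarrow> \<chi> \<in> Y)"

text \<open>Ranges over all formulas and not only those in \<open>F\<close>, since E4 and E6 will
  transport formulas that need not lie in \<open>F\<close>.\<close>

definition "sees T V W \<longleftrightarrow> (\<forall>G\<in>T. \<forall>\<chi>. E G \<chi> \<in> V \<longrightarrow> \<chi> \<in> W)"

text \<open>All that is asked of a frame condition \<open>P\<close>. The last clause demands a
  relation for one edge at a time, never for several edges together.\<close>

definition "supports P \<longleftrightarrow>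
  (\<forall>i\<in>J. \<exists>r. P r \<and> named_rel i r) \<and>
  (\<forall>i\<in>A - J. \<exists>r. P r \<and> group_rel (memb i) r) \<and>
  (\<forall>i\<in>A - J. \<forall>V W X. rep V X \<longrightarrow> mcs W \<longrightarrow> sees (memb i) V W \<longrightarrow>
    (\<exists>r Y. P r \<and> group_rel (memb i) r \<and> (X, Y) \<in> r \<and> rep W Y))"

lemma rep_mem: "rep V X \<Longrightarrow> \<phi> \<in> F \<Longrightarrow> \<phi> \<in> X \<longleftrightarrow> \<phi> \<in> V"
  unfolding rep_def by blast

lemma rep_mcs: "rep V X \<Longrightarrow> mcs V"
  unfolding rep_def by blast

lemma rep_S: "rep V X \<Longrightarrow> X \<in> S"
  unfolding S_def by blast

lemma rep_restrict: "mcs V \<Longrightarrow> rep V (V \<inter> F)"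
  unfolding rep_def by blast

lemma finite_S: "finite S"
  by (rule finite_subset [of _ "Pow (insert m F)"]) (auto simp: S_def rep_def finite_F)

lemma finite_Gr: "finite Gr"
  unfolding Gr_def using finite_F by (rule finite_groups)

lemma Gr_subset: "G \<in> Gr \<Longrightarrow> G \<in> \<G>"
  unfolding Gr_def using F_subset by auto

lemma infinite_memb: "i \<in> A - J \<Longrightarrow> infinite {i' \<in> A - J. memb i' = memb i}"
proof -
  assume i: "i \<in> A - J"
  have eq: "memb i' = memb i \<longleftrightarrow> (\<forall>G \<phi>. E G \<phi> \<in> F \<longrightarrow> (i' \<in> G \<longleftrightarrow> i \<in> G))" for i'
    unfolding memb_def Gr_def by blast
  have "infinite ({i' \<in> A. memb i' = memb i} - J)"
    unfolding eq using unnamed [OF i] finite_J by (rule Diff_infinite_finite [rotated])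
  moreover have "{i' \<in> A. memb i' = memb i} - J = {i' \<in> A - J. memb i' = memb i}" by blast
  ultimately show ?thesis by simp
qed

text \<open>A prescribed edge is a triple of source, type and target, and there are finitely many.
  The injective \<open>a\<close> gives each an owner of that type, so an agent owes at most one
  edge; agents owing none take a default relation. The edge promised for \<open>i\<close> may
  therefore belong to another agent \<open>i'\<close> of the same type.\<close>

lemma accessibility:
  assumes P: "supports P"
  obtains R where "\<And>i. i \<in> A \<Longrightarrow> P (R i)" "\<And>i. i \<in> J \<Longrightarrow> named_rel i (R i)"
    "\<And>i. i \<in> A - J \<Longrightarrow> group_rel (memb i) (R i)"
    "\<And>i V W X. i \<in> A - J \<Longrightarrow> rep V X \<Longrightarrow> mcs W \<Longrightarrow> sees (memb i) V W \<Longrightarrow>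
      \<exists>i'\<in>A - J. \<exists>Y. memb i' = memb i \<and> (X, Y) \<in> R i' \<and> rep W Y"
proof -
  define N where "N = {(X, T, Y). X \<in> S \<and> Y \<in> S \<and> T \<in> Pow Gr \<and> T \<in> memb ` (A - J) \<and>
    (\<exists>r. P r \<and> group_rel T r \<and> (X, Y) \<in> r)}"
  have "finite N"
    by (rule finite_subset [of _ "S \<times> Pow Gr \<times> S"]) (auto simp: N_def finite_S finite_Gr)
  moreover have "infinite {i \<in> A - J. memb i = fst (snd n)}" if "n \<in> N" for n
    using that infinite_memb by (auto simp: N_def)
  ultimately obtain a where inj: "inj_on a N"
    and a: "\<forall>n\<in>N. a n \<in> {i \<in> A - J. memb i = fst (snd n)}"
    using distinct_representatives [of N "\<lambda>n. {i \<in> A - J. memb i = fst (snd n)}"] by blast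
  \<comment> \<open>All duties of an agent go under one existential quantifier, so that a single
    choice of relations meets them together.\<close>
  have ex: "\<exists>r. P r \<and> (i \<in> J \<longrightarrow> named_rel i r) \<and> (i \<in> A - J \<longrightarrow> group_rel (memb i) r \<and>
      (\<forall>X T Y. (X, T, Y) \<in> N \<longrightarrow> a (X, T, Y) = i \<longrightarrow> (X, Y) \<in> r))" if i: "i \<in> A" for i
  proof (cases "i \<in> J")
    case True
    then show ?thesis using P unfolding supports_def by blast
  next
    case False
    show ?thesis
    proof (cases "\<exists>X T Y. (X, T, Y) \<in> N \<and> a (X, T, Y) = i")
      case True
      then obtain X T Y where XTY: "(X, T, Y) \<in> N" "a (X, T, Y) = i" by blast
      then have T: "T = memb i" using a by fastforce
      obtain r where r: "P r" "group_rel T r" "(X, Y) \<in> r"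
        using XTY(1) unfolding N_def by blast
      have "(X', T', Y') = (X, T, Y)" if "(X', T', Y') \<in> N" "a (X', T', Y') = i" for X' T' Y'
        using inj that XTY by (metis inj_onD)
      then show ?thesis
        using r False unfolding T by (intro exI [of _ r]) auto
    next
      case False
      obtain r where "P r" "group_rel (memb i) r"
        using P i \<open>i \<notin> J\<close> unfolding supports_def by blast
      then show ?thesis using False \<open>i \<notin> J\<close> by blast
    qed
  qed
  then obtain R where R: "\<And>i. i \<in> A \<Longrightarrow> P (R i) \<and> (i \<in> J \<longrightarrow> named_rel i (R i)) \<and>
    (i \<in> A - J \<longrightarrow> group_rel (memb i) (R i) \<and>
      (\<forall>X T Y. (X, T, Y) \<in> N \<longrightarrow> a (X, T, Y) = i \<longrightarrow> (X, Y) \<in> R i))"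
    by metis
  show thesis
  proof (rule that [of R])
    show "P (R i)" if "i \<in> A" for i using R that by blast
    show "named_rel i (R i)" if "i \<in> J" for i using R that J_subset by blast
    show "group_rel (memb i) (R i)" if "i \<in> A - J" for i using R that by blast
    fix i V W X
    assume i: "i \<in> A - J" and V: "rep V X" and W: "mcs W" "sees (memb i) V W"
    then obtain r Y where r: "P r" "group_rel (memb i) r" "(X, Y) \<in> r" "rep W Y"
      using P unfolding supports_def by blast
    then have N: "(X, memb i, Y) \<in> N"
      using i V rep_S unfolding N_def by (auto simp: memb_def)
    define i' where "i' = a (X, memb i, Y)"
    have i': "i' \<in> A - J" "memb i' = memb i"
      using a N unfolding i'_def by fastforce+
    then have "(X, Y) \<in> R i'"
      using R N unfolding i'_def by blast
    then show "\<exists>i'\<in>A - J. \<exists>Y. memb i' = memb i \<and> (X, Y) \<in> R i' \<and> rep W Y"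
      using i' r(4) by blast
  qed
qed

text \<open>The witness conditions are required of every mcs with the same trace as the state and of
  every formula of the language: \<open>C\<close> needs them for a formula outside \<open>F\<close>.\<close>

lemma truth_lemma:
  assumes R: "\<And>i. i \<in> A \<Longrightarrow> acc M i \<subseteq> S \<times> S"
    and val: "\<And>X p. val M X p \<longleftrightarrow> Pro p \<in> X"
    and K: "\<And>i X Y \<chi>. (X, Y) \<in> acc M i \<Longrightarrow> K i \<chi> \<in> F \<Longrightarrow> K i \<chi> \<in> X \<Longrightarrow> \<chi> \<in> Y"
    and E: "\<And>G i X Y \<chi>. (X, Y) \<in> acc M i \<Longrightarrow> i \<in> G \<Longrightarrow> E G \<chi> \<in> F \<Longrightarrow> E G \<chi> \<in> X \<Longrightarrow> \<chi> \<in> Y"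
    and nK: "\<And>i V X \<chi>. i \<in> J \<Longrightarrow> rep V X \<Longrightarrow> \<chi> \<in> Lang \<Longrightarrow> K i \<chi> \<notin> V \<Longrightarrow>
      \<exists>Y W. (X, Y) \<in> acc M i \<and> rep W Y \<and> \<chi> \<notin> W"
    and nE: "\<And>G V X \<chi>. G \<in> Gr \<Longrightarrow> rep V X \<Longrightarrow> \<chi> \<in> Lang \<Longrightarrow> E G \<chi> \<notin> V \<Longrightarrow>
      \<exists>i\<in>G. \<exists>Y W. (X, Y) \<in> acc M i \<and> rep W Y \<and> \<chi> \<notin> W"
    and \<phi>: "\<phi> \<in> F" and X: "X \<in> S"
  shows "sat M X \<phi> \<longleftrightarrow> \<phi> \<in> X"
  using \<phi> X
proof (induction \<phi> arbitrary: X)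
  case (Pro p)
  then show ?case by (simp add: val)
next
  case (Neg \<phi>)
  then obtain V where V: "rep V X" unfolding S_def by blast
  have "\<phi> \<in> F" using F_Neg Neg.prems by blast
  moreover have "\<phi> \<in> Lang" using \<open>\<phi> \<in> F\<close> F_subset by blast
  ultimately show ?case
    using Neg mcs_Neg [OF rep_mcs [OF V]] rep_mem [OF V] by simp
next
  case (Conj \<phi> \<psi>)
  then obtain V where V: "rep V X" unfolding S_def by blast
  have "\<phi> \<in> F" "\<psi> \<in> F" using F_Conj Conj.prems by blast+
  then show ?case
    using Conj mcs_Conj [OF rep_mcs [OF V]] rep_mem [OF V] by simp
next
  case (K i \<phi>)
  then obtain V where V: "rep V X" unfolding S_def by blast
  have F: "i \<in> J" "\<phi> \<in> F" using F_K K.prems by blast+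
  have S: "Y \<in> S" if "(X, Y) \<in> acc M i" for Y
    using R [of i] J_subset F(1) that by blast
  show ?case
  proof
    assume sat: "sat M X (K i \<phi>)"
    show "K i \<phi> \<in> X"
    proof (rule ccontr)
      assume "K i \<phi> \<notin> X"
      then obtain Y W where Y: "(X, Y) \<in> acc M i" "rep W Y" "\<phi> \<notin> W"
        using nK [OF F(1) V, of \<phi>] rep_mem [OF V] K.prems F F_subset by blast
      then have "\<phi> \<notin> Y" using rep_mem F(2) by blast
      then show False
        using K.IH [OF F(2) S [OF Y(1)]] sat Y(1) by simp
    qed
  next
    assume "K i \<phi> \<in> X"
    then show "sat M X (K i \<phi>)"
      using K.IH [OF F(2) S] assms(3) K.prems(1) by simp
  qed
next
  case (E G \<phi>)
  then obtain V where V: "rep V X" unfolding S_def by blast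
  have F: "\<phi> \<in> F" "G \<in> Gr" using F_E E.prems unfolding Gr_def by blast+
  have S: "Y \<in> S" if "(X, Y) \<in> acc M i" "i \<in> G" for Y i
    using R [of i] groups [OF Gr_subset [OF F(2)]] that by blast
  show ?case
  proof
    assume sat: "sat M X (E G \<phi>)"
    show "E G \<phi> \<in> X"
    proof (rule ccontr)
      assume "E G \<phi> \<notin> X"
      then obtain i Y W where Y: "i \<in> G" "(X, Y) \<in> acc M i" "rep W Y" "\<phi> \<notin> W"
        using nE [OF F(2) V, of \<phi>] rep_mem [OF V] E.prems F F_subset by blast
      then have "\<phi> \<notin> Y" using rep_mem F(1) by blast
      then show False
        using E.IH [OF F(1) S [OF Y(2,1)]] sat Y(1,2) by simp
    qed
  next
    assume "E G \<phi> \<in> X"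
    then show "sat M X (E G \<phi>)"
      using E.IH [OF F(1) S] assms(4) E.prems(1) by simp
  qed
next
  case (C G \<phi>)
  have EF: "E G (\<phi> \<^bold>\<and> C G \<phi>) \<in> F" using F_C C.prems by blast
  then have F: "\<phi> \<in> F" "G \<in> Gr" using F_E F_Conj unfolding Gr_def by blast+
  have lang: "\<phi> \<in> Lang" "G \<in> \<G>" using F F_subset Gr_subset by blast+
  have S: "Y \<in> S" if "(Z, Y) \<in> acc M i" "i \<in> G" for Y Z i
    using R [of i] groups [OF lang(2)] that by blast
  show ?case
  proof
    assume "C G \<phi> \<in> X"
    \<comment> \<open>\<open>F_C\<close> keeps the right-hand side of C1 in \<open>F\<close>, so
      that \<open>C G \<phi>\<close> travels along every edge together with
      \<open>\<phi>\<close>.\<close>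
    have edge: "Y \<in> S \<and> \<phi> \<in> Y \<and> C G \<phi> \<in> Y"
      if Z: "Z \<in> S" "C G \<phi> \<in> Z" and i: "i \<in> G" "(Z, Y) \<in> acc M i" for Z Y i
    proof -
      obtain V where V: "rep V Z" using Z unfolding S_def by blast
      have "C G \<phi> \<in> V" using rep_mem [OF V C.prems(1)] Z(2) by simp
      then have "E G (\<phi> \<^bold>\<and> C G \<phi>) \<in> Z"
        using mcs_C1 [OF rep_mcs [OF V]] rep_mem [OF V EF] by simp
      then have conj: "\<phi> \<^bold>\<and> C G \<phi> \<in> Y"
        using assms(4) [OF i(2,1) EF] by simp
      obtain W where W: "rep W Y" using S [OF i(2,1)] unfolding S_def by blast
      show ?thesis
        using conj S [OF i(2,1)] mcs_Conj [OF rep_mcs [OF W]] rep_mem [OF W] F_E [OF EF] F(1) C.prems(1)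
        by simp
    qed
    have "Y \<in> S \<and> \<phi> \<in> Y \<and> C G \<phi> \<in> Y" if "(X, Y) \<in> (\<Union>i\<in>G. acc M i)\<^sup>+" for Y
      using that
    proof (induction rule: trancl_induct)
      case (base Y)
      then show ?case using edge [OF C.prems(2) \<open>C G \<phi> \<in> X\<close>] by blast
    next
      case (step Y Z)
      then show ?case using edge [of Y _ Z] by blast
    qed
    then show "sat M X (C G \<phi>)"
      unfolding sat_C using C.IH [OF F(1)] by blast
  next
    assume sat: "sat M X (C G \<phi>)"
    \<comment> \<open>The invariant for RC1 defines the truth of \<open>C G \<phi>\<close> in
      \<open>M\<close> as a property of traces. The two copies of a trace are not yet known to agree
      on it, hence the existential over \<open>Y\<close>.\<close>
    obtain \<theta> where \<theta>: "\<theta> \<in> Lang"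
      "\<And>V. mcs V \<Longrightarrow> \<theta> \<in> V \<longleftrightarrow> (\<exists>Y. rep V Y \<and> sat M Y (C G \<phi>))"
    proof -
      obtain \<theta> where "\<theta> \<in> Lang"
        "\<forall>V. mcs V \<longrightarrow> (\<theta> \<in> V \<longleftrightarrow> (\<exists>Y. Y \<subseteq> insert m F \<and> Y \<inter> F = V \<inter> F \<and> sat M Y (C G \<phi>)))"
        using definable [OF finite_F F_subset lang(1),
            of "\<lambda>Z. \<exists>Y. Y \<subseteq> insert m F \<and> Y \<inter> F = Z \<and> sat M Y (C G \<phi>)"] by blast
      then show thesis by (intro that [of \<theta>]) (simp_all add: rep_def)
    qed
    \<comment> \<open>Otherwise \<open>nE\<close>, applied to the conjunction of
      \<open>\<phi>\<close> and \<open>\<theta>\<close>, gives an edge from a state where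
      \<open>C G \<phi>\<close> is true. By \<open>sat_C_unfold\<close> both \<open>\<phi>\<close>
      and \<open>C G \<phi>\<close> are true at its target, so \<open>W\<close> contains both
      conjuncts.\<close>
    have "\<theta> \<^bold>\<longrightarrow> E G (\<phi> \<^bold>\<and> \<theta>) \<in> V" if V: "mcs V" for V
    proof (rule ccontr)
      assume "\<theta> \<^bold>\<longrightarrow> E G (\<phi> \<^bold>\<and> \<theta>) \<notin> V"
      then have "\<theta> \<in> V" and notin: "E G (\<phi> \<^bold>\<and> \<theta>) \<notin> V"
        using mcs_Imp [OF V \<theta>(1), of "E G (\<phi> \<^bold>\<and> \<theta>)"] \<theta>(1) lang by simp_all
      then obtain Y where Y: "rep V Y" "sat M Y (C G \<phi>)" using \<theta>(2) [OF V] by blast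
      have "\<phi> \<^bold>\<and> \<theta> \<in> Lang" using lang(1) \<theta>(1) by simp
      then obtain i Z W where Z: "i \<in> G" "(Y, Z) \<in> acc M i" "rep W Z" "\<phi> \<^bold>\<and> \<theta> \<notin> W"
        using nE [OF F(2) Y(1) _ notin] by blast
      have "sat M Z \<phi>" "sat M Z (C G \<phi>)"
        using Y(2) Z(1,2) unfolding sat_C_unfold [of M Y] by blast+
      then have "\<phi> \<in> W" "\<theta> \<in> W"
        using C.IH [OF F(1) rep_S [OF Z(3)]] rep_mem [OF Z(3) F(1)] \<theta>(2) [OF rep_mcs [OF Z(3)]] Z(3)
        by blast+
      then show False using Z(4) mcs_Conj [OF rep_mcs [OF Z(3)]] by blast
    qed
    then have "\<theta> \<^bold>\<longrightarrow> E G (\<phi> \<^bold>\<and> \<theta>) \<in> Thms"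
      using \<theta>(1) lang by (simp add: theorem_iff_mcs)
    then have derivable: "\<theta> \<^bold>\<longrightarrow> C G \<phi> \<in> Thms"
      using lang(2) by (rule theorems.RC1)
    obtain V where V: "rep V X" using C.prems unfolding S_def by blast
    then have "\<theta> \<in> V" using \<theta>(2) [OF rep_mcs [OF V]] sat by blast
    then have "C G \<phi> \<in> V"
      using mcs_MP [OF rep_mcs [OF V]] theory_theorem [OF mcs_theory [OF rep_mcs [OF V]] derivable] by blast
    then show "C G \<phi> \<in> X" using rep_mem [OF V C.prems(1)] by simp
  qed
qed

lemma countermodel:
  assumes P: "supports P"
  obtains M where "states M = S" "\<And>i. i \<in> A \<Longrightarrow> acc M i \<subseteq> S \<times> S" "\<And>i. i \<in> A \<Longrightarrow> P (acc M i)"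
    "\<And>X \<phi>. X \<in> S \<Longrightarrow> \<phi> \<in> F \<Longrightarrow> sat M X \<phi> \<longleftrightarrow> \<phi> \<in> X"
proof -
  obtain R where R: "\<And>i. i \<in> A \<Longrightarrow> P (R i)" "\<And>i. i \<in> J \<Longrightarrow> named_rel i (R i)"
    "\<And>i. i \<in> A - J \<Longrightarrow> group_rel (memb i) (R i)"
    "\<And>i V W X. i \<in> A - J \<Longrightarrow> rep V X \<Longrightarrow> mcs W \<Longrightarrow> sees (memb i) V W \<Longrightarrow>
      \<exists>i'\<in>A - J. \<exists>Y. memb i' = memb i \<and> (X, Y) \<in> R i' \<and> rep W Y"
    using accessibility [OF P] by blast
  define M where "M = \<lparr>states = S, val = (\<lambda>X p. Pro p \<in> X), acc = R\<rparr>"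
  have sub: "R i \<subseteq> S \<times> S" if "i \<in> A" for i
    using R(2) [of i] R(3) [of i] that unfolding named_rel_def group_rel_def by blast
  have K: "\<chi> \<in> Y" if "(X, Y) \<in> R i" "K i \<chi> \<in> F" "K i \<chi> \<in> X" for i X Y \<chi>
    using R(2) [of i] F_K [OF that(2)] that unfolding named_rel_def by blast
  have E: "\<chi> \<in> Y" if *: "(X, Y) \<in> R i" "i \<in> G" "E G \<chi> \<in> F" "E G \<chi> \<in> X" for G i X Y \<chi>
  proof -
    have G: "G \<in> Gr" using * unfolding Gr_def by blast
    then have i: "i \<in> A" using groups [OF Gr_subset] * by blast
    show ?thesis
    proof (cases "i \<in> J")
      case True
      \<comment> \<open>A named agent's relation tracks only \<open>K i\<close> formulas. E1 turns
        \<open>E G \<chi>\<close> into \<open>K i \<chi>\<close>, and \<open>F_E_K\<close> makes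
        that formula visible to the filtration.\<close>
      then have KF: "K i \<chi> \<in> F" using F_E_K * by blast
      obtain V where V: "rep V X" using sub [OF i] * unfolding S_def by blast
      have "K i \<chi> \<in> V" using mcs_E1 [OF rep_mcs [OF V] _ *(2)] rep_mem [OF V *(3)] *(4) by simp
      then show ?thesis using K [OF *(1) KF] rep_mem [OF V KF] by simp
    next
      case False
      then show ?thesis
        using R(3) [of i] i * G unfolding group_rel_def memb_def by blast
    qed
  qed
  have nK: "\<exists>Y W. (X, Y) \<in> R i \<and> rep W Y \<and> \<chi> \<notin> W"
    if *: "i \<in> J" "rep V X" "\<chi> \<in> Lang" "K i \<chi> \<notin> V" for i V X \<chi>
  proof -
    have "i \<in> A" using * J_subset by blast
    then obtain W where W: "mcs W" "\<And>\<chi>. K i \<chi> \<in> V \<Longrightarrow> \<chi> \<in> W" "\<chi> \<notin> W"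
      using K_witness [OF rep_mcs [OF *(2)] _ *(3,4)] by blast
    then have "(X, W \<inter> F) \<in> R i"
      using R(2) [OF *(1)] *(2) rep_restrict [OF W(1)] unfolding named_rel_def by blast
    then show ?thesis using rep_restrict [OF W(1)] W(3) by blast
  qed
  have nE: "\<exists>i\<in>G. \<exists>Y W. (X, Y) \<in> R i \<and> rep W Y \<and> \<chi> \<notin> W"
    if *: "G \<in> Gr" "rep V X" "\<chi> \<in> Lang" "E G \<chi> \<notin> V" for G V X \<chi>
  proof (cases "\<exists>j\<in>J \<inter> G. K j \<chi> \<notin> V")
    \<comment> \<open>Either a named agent of \<open>G\<close> fails to know \<open>\<chi>\<close>
      and its filtered relation has the edge, or \<open>E_witness\<close> applies with
      \<open>J\<close> as the set of exceptions. In the second case the owner of the edge has the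
      type of \<open>i\<close>, hence is in \<open>G\<close> too.\<close>
    case True
    then show ?thesis using nK [OF _ *(2,3)] by blast
  next
    case False
    then obtain i W where W: "i \<in> G - J" "mcs W" "\<chi> \<notin> W"
      and Gr: "\<And>H \<psi>. H \<in> Gr \<Longrightarrow> i \<in> H \<Longrightarrow> E H \<psi> \<in> V \<Longrightarrow> \<psi> \<in> W"
      using E_witness [OF rep_mcs [OF *(2)] Gr_subset [OF *(1)] *(3,4) finite_J finite_Gr] by blast
    have "sees (memb i) V W" using Gr unfolding sees_def memb_def by blast
    moreover have "i \<in> A - J" using W(1) groups [OF Gr_subset [OF *(1)]] by blast
    ultimately obtain i' Y where "memb i' = memb i" "(X, Y) \<in> R i'" "rep W Y"
      using R(4) [OF _ *(2) W(2)] by blast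
    moreover have "i' \<in> G" using \<open>memb i' = memb i\<close> W(1) *(1) unfolding memb_def by blast
    ultimately show ?thesis using W(3) by blast
  qed
  show thesis
  proof (rule that [of M])
    show "sat M X \<phi> \<longleftrightarrow> \<phi> \<in> X" if "X \<in> S" "\<phi> \<in> F" for X \<phi>
    proof (rule truth_lemma [OF _ _ _ _ _ _ that(2,1)], unfold M_def kripke.simps)
      show "(Pro p \<in> Y) = (Pro p \<in> Y)" for Y p ..
    qed (fact sub K E nK nE)+
  qed (simp_all add: M_def sub R(1))
qed

lemma refutation:
  assumes P: "supports P" and V: "mcs V" "\<phi> \<notin> V" and F: "\<phi> \<in> F"
  shows "\<exists>M\<in>M_all A. states M = S \<and> (\<forall>i\<in>A. P (acc M i)) \<and> (\<exists>X\<in>S. \<not> sat M X \<phi>)"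
proof -
  obtain M where M: "states M = S" "\<And>i. i \<in> A \<Longrightarrow> acc M i \<subseteq> S \<times> S" "\<And>i. i \<in> A \<Longrightarrow> P (acc M i)"
    "\<And>X \<phi>. X \<in> S \<Longrightarrow> \<phi> \<in> F \<Longrightarrow> sat M X \<phi> \<longleftrightarrow> \<phi> \<in> X"
    using countermodel [OF P] by blast
  have VS: "V \<inter> F \<in> S" using rep_restrict [OF V(1)] by (rule rep_S)
  have "M \<in> M_all A" using M(1,2) unfolding M_all_def by simp
  moreover have "\<not> sat M (V \<inter> F) \<phi>" using M(4) [OF VS F] V(2) by blast
  ultimately show ?thesis using M(1,3) VS by blast
qed

end

section \<open>The closure of a formula and the choice of named agents\<close>

primrec closure :: "('p, 'a) fm \<Rightarrow> ('p, 'a) fm set" where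
  "closure (Pro p) = {Pro p}"
| "closure (\<^bold>\<not> \<phi>) = insert (\<^bold>\<not> \<phi>) (closure \<phi>)"
| "closure (\<phi> \<^bold>\<and> \<psi>) = insert (\<phi> \<^bold>\<and> \<psi>) (closure \<phi> \<union> closure \<psi>)"
| "closure (K i \<phi>) = insert (K i \<phi>) (closure \<phi>)"
| "closure (E G \<phi>) = insert (E G \<phi>) (closure \<phi>)"
| "closure (C G \<phi>) = {C G \<phi>, \<phi> \<^bold>\<and> C G \<phi>, E G (\<phi> \<^bold>\<and> C G \<phi>)} \<union> closure \<phi>"

lemma closure_refl: "\<phi> \<in> closure \<phi>"
  by (cases \<phi>) auto

text \<open>A closure of Fischer-Ladner kind: unfolding \<open>C G \<phi>\<close> by C1 leads back
  to \<open>C G \<phi>\<close> itself, so one unfolding suffices.\<close>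

lemma finite_closure: "finite (closure \<phi>)"
  by (induction \<phi>) auto

lemma closure_lang: "\<phi> \<in> lang \<Phi> A \<G> \<Longrightarrow> closure \<phi> \<subseteq> lang \<Phi> A \<G>"
  by (induction \<phi>) auto

lemma closure_Neg: "\<^bold>\<not> \<psi> \<in> closure \<phi> \<Longrightarrow> \<psi> \<in> closure \<phi>"
  by (induction \<phi>) (auto simp: closure_refl)

lemma closure_Conj: "\<psi> \<^bold>\<and> \<chi> \<in> closure \<phi> \<Longrightarrow> \<psi> \<in> closure \<phi> \<and> \<chi> \<in> closure \<phi>"
  by (induction \<phi>) (auto simp: closure_refl)

lemma closure_K: "K i \<psi> \<in> closure \<phi> \<Longrightarrow> \<psi> \<in> closure \<phi>"
  by (induction \<phi>) (auto simp: closure_refl)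

lemma closure_E: "E G \<psi> \<in> closure \<phi> \<Longrightarrow> \<psi> \<in> closure \<phi>"
  by (induction \<phi>) (auto simp: closure_refl)

lemma closure_C: "C G \<psi> \<in> closure \<phi> \<Longrightarrow> E G (\<psi> \<^bold>\<and> C G \<psi>) \<in> closure \<phi>"
  by (induction \<phi>) (auto simp: closure_refl)

text \<open>\<open>Neg\<close> is injective but misses every \<open>Pro p\<close>. The infinite
  supply yields a marker outside \<open>F\<close>; being a formula, it leaves states of type
  \<open>fm_state\<close>.\<close>

lemma infinite_UNIV_fm: "infinite (UNIV :: ('p, 'a) fm set)"
proof
  assume "finite (UNIV :: ('p, 'a) fm set)"
  moreover have "inj (Neg :: ('p, 'a) fm \<Rightarrow> _)" by (simp add: inj_def)
  ultimately have "surj (Neg :: ('p, 'a) fm \<Rightarrow> _)" by (rule finite_UNIV_inj_surj)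
  from surjD [OF this, of "Pro undefined"]
  obtain \<phi> where "(Pro undefined :: ('p, 'a) fm) = \<^bold>\<not> \<phi>" ..
  then show False by simp
qed

text \<open>Agents are sorted by membership in the finitely many groups of the closure.
  \<open>J1\<close> collects the agents mentioned by \<open>K\<close>, \<open>J2\<close> those in
  finite classes; every class that meets the complement of \<open>J\<close> in \<open>A\<close> is
  infinite.\<close>

lemma (in axiom_system) filtration_exists:
  assumes \<phi>: "\<phi> \<in> Lang"
  shows "\<exists>F J m. filtration \<Phi> A \<G> Ax F J m \<and> \<phi> \<in> F"
proof -
  let ?D = "closure \<phi>"
  define cls where "cls i = {i' \<in> A. \<forall>G \<psi>. E G \<psi> \<in> ?D \<longrightarrow> (i' \<in> G \<longleftrightarrow> i \<in> G)}" for i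
  define J1 where "J1 = {i. \<exists>\<psi>. K i \<psi> \<in> ?D}"
  define J2 where "J2 = {i \<in> A. finite (cls i)}"
  define J where "J = J1 \<union> J2"
  \<comment> \<open>The added formulas \<open>K j \<psi>\<close> let the named members of a group
    inherit its \<open>E G\<close> formulas.\<close>
  define F where "F = ?D \<union> {K j \<psi> | j \<psi>. j \<in> J \<and> (\<exists>G. E G \<psi> \<in> ?D \<and> j \<in> G)}"
  have lang: "?D \<subseteq> Lang" using closure_lang [OF \<phi>] .
  have J1: "finite J1" unfolding J1_def by (intro finite_agents finite_closure)
  define Gs where "Gs = {G. \<exists>\<psi>. E G \<psi> \<in> ?D}"
  have Gs: "finite Gs" unfolding Gs_def by (intro finite_groups finite_closure)
  have cls_eq: "cls i = {i' \<in> A. {G \<in> Gs. i' \<in> G} = {G \<in> Gs. i \<in> G}}" for i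
    unfolding cls_def Gs_def by blast
  \<comment> \<open>A class is determined by a subset of \<open>Gs\<close>, so \<open>J2\<close> is
    a finite union of finite classes even if \<open>A\<close> is infinite.\<close>
  have "finite (cls ` A)"
  proof (rule finite_subset)
    show "cls ` A \<subseteq> (\<lambda>T. {i' \<in> A. {G \<in> Gs. i' \<in> G} = T}) ` Pow Gs"
      unfolding cls_eq by blast
  qed (use Gs in simp)
  then have "finite (\<Union>{c \<in> cls ` A. finite c})"
    by (intro finite_Union) auto
  moreover have "J2 \<subseteq> \<Union>{c \<in> cls ` A. finite c}"
    unfolding J2_def cls_def by blast
  ultimately have J2: "finite J2" by (rule finite_subset [rotated])
  have J: "finite J" "J \<subseteq> A"
    using J1 J2 lang by (auto simp: J_def J1_def J2_def)
  have "{K j \<psi> | j \<psi>. j \<in> J \<and> (\<exists>G. E G \<psi> \<in> ?D \<and> j \<in> G)} \<subseteq> (\<lambda>(j, \<psi>). K j \<psi>) ` (J \<times> ?D)"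
    using closure_E by fastforce
  then have F: "finite F"
    using finite_surj [of "J \<times> ?D"] J(1) finite_closure [of \<phi>] unfolding F_def by blast
  obtain m where m: "m \<notin> F"
    using ex_new_if_finite [OF infinite_UNIV_fm F] by blast
  \<comment> \<open>Enlarging the closure adds no \<open>E\<close> formula, so the classes computed
    from the closure are those of \<open>F\<close>.\<close>
  have E: "E G \<psi> \<in> F \<longleftrightarrow> E G \<psi> \<in> ?D" for G \<psi> by (simp add: F_def)
  have "filtration \<Phi> A \<G> Ax F J m"
  proof unfold_locales
    have "\<psi> \<in> Lang" if "E G \<psi> \<in> ?D" for G \<psi>
      using lang closure_E [OF that] by blast
    then show "F \<subseteq> Lang" using lang J(2) by (auto simp: F_def)
    show "infinite {i' \<in> A. \<forall>G \<psi>. E G \<psi> \<in> F \<longrightarrow> (i' \<in> G \<longleftrightarrow> i \<in> G)}" if "i \<in> A - J" for i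
      using that unfolding E J_def J2_def cls_def [symmetric] by simp
    show "i \<in> J \<and> \<psi> \<in> F" if "K i \<psi> \<in> F" for i \<psi>
    proof -
      have "\<psi> \<in> ?D"
        using that closure_K [of i \<psi> \<phi>] closure_E [of _ \<psi> \<phi>] by (auto simp: F_def)
      then show ?thesis using that by (auto simp: F_def J_def J1_def)
    qed
    show "\<psi> \<in> F" if "E G \<psi> \<in> F" for G \<psi>
      using that closure_E [of G \<psi> \<phi>] unfolding E by (simp add: F_def)
    show "K j \<psi> \<in> F" if "E G \<psi> \<in> F" "j \<in> J" "j \<in> G" for G j \<psi>
      using that unfolding E by (auto simp: F_def)
    show "E G (\<psi> \<^bold>\<and> C G \<psi>) \<in> F" if "C G \<psi> \<in> F" for G \<psi>
      using that closure_C [of G \<psi> \<phi>] unfolding E by (simp add: F_def)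
    show "\<psi> \<in> F" if "\<^bold>\<not> \<psi> \<in> F" for \<psi>
      using that closure_Neg [of \<psi> \<phi>] by (simp add: F_def)
    show "\<psi> \<in> F \<and> \<chi> \<in> F" if "\<psi> \<^bold>\<and> \<chi> \<in> F" for \<psi> \<chi>
      using that closure_Conj [of \<psi> \<chi> \<phi>] by (simp add: F_def)
    show "F \<noteq> {}" using closure_refl [of \<phi>] by (auto simp: F_def)
  qed (use F J m in simp_all)
  then show ?thesis using closure_refl [of \<phi>] unfolding F_def by blast
qed

text \<open>\<open>P\<close> takes the set of states as an argument because reflexivity and
  seriality refer to it.\<close>

lemma (in axiom_system) completeness:
  assumes supports: "\<And>F J m. filtration \<Phi> A \<G> Ax F J m \<Longrightarrow>
      filtration.supports \<Phi> A \<G> Ax F J m (P (filtration.S \<Phi> A \<G> Ax F m))"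
  shows "complete Lang Thms {M \<in> M_all A. \<forall>i\<in>A. P (states M) (acc M i)}"
  unfolding complete_def
proof (intro ballI impI)
  fix \<phi> assume \<phi>: "\<phi> \<in> Lang"
    and valid: "valid_in {M \<in> M_all A. \<forall>i\<in>A. P (states M) (acc M i)} \<phi>"
  show "\<phi> \<in> Thms"
  proof (rule ccontr)
    assume "\<phi> \<notin> Thms"
    then obtain V where V: "mcs V" "\<phi> \<notin> V" using theorem_iff_mcs [OF \<phi>] by blast
    obtain F J m where filt: "filtration \<Phi> A \<G> Ax F J m" and F: "\<phi> \<in> F"
      using filtration_exists [OF \<phi>] by blast
    then have "\<exists>M\<in>M_all A. states M = filtration.S \<Phi> A \<G> Ax F m \<and>
        (\<forall>i\<in>A. P (filtration.S \<Phi> A \<G> Ax F m) (acc M i)) \<and>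
        (\<exists>X\<in>filtration.S \<Phi> A \<G> Ax F m. \<not> sat M X \<phi>)"
      using filtration.refutation [OF filt supports [OF filt] V F] by blast
    then obtain M X where "M \<in> M_all A" "\<forall>i\<in>A. P (states M) (acc M i)"
      and X: "X \<in> states M" "\<not> sat M X \<phi>" by metis
    then have "sat M X \<phi>" using valid unfolding valid_in_def by blast
    then show False using X(2) by blast
  qed
qed

section \<open>The five systems\<close>

text \<open>Without constants every formula contains a primitive proposition; it provides the
  \<open>Fls p\<close> of K3.\<close>

lemma lang_nonempty: "\<phi> \<in> lang \<Phi> A \<G> \<Longrightarrow> \<exists>p. p \<in> \<Phi>"
  by (induction \<phi>) auto

context axiom_system
begin

lemma mcs_K2: "K2 \<Phi> A \<G> \<subseteq> Ax \<Longrightarrow> mcs V \<Longrightarrow> K i \<phi> \<in> V \<Longrightarrow> \<phi> \<in> V"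
proof -
  assume ax: "K2 \<Phi> A \<G> \<subseteq> Ax" and V: "mcs V" and \<phi>: "K i \<phi> \<in> V"
  have "K i \<phi> \<^bold>\<longrightarrow> \<phi> \<in> K2 \<Phi> A \<G>"
    using mcs_in_lang [OF V \<phi>] unfolding K2_def by auto
  then show "\<phi> \<in> V" using ax mcs_axiom_Imp [OF V _ \<phi>] by blast
qed

lemma mcs_K4: "K4 \<Phi> A \<G> \<subseteq> Ax \<Longrightarrow> mcs V \<Longrightarrow> K i \<phi> \<in> V \<Longrightarrow> K i (K i \<phi>) \<in> V"
proof -
  assume ax: "K4 \<Phi> A \<G> \<subseteq> Ax" and V: "mcs V" and \<phi>: "K i \<phi> \<in> V"
  have "K i \<phi> \<^bold>\<longrightarrow> K i (K i \<phi>) \<in> K4 \<Phi> A \<G>"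
    using mcs_in_lang [OF V \<phi>] unfolding K4_def by auto
  then show "K i (K i \<phi>) \<in> V" using ax mcs_axiom_Imp [OF V _ \<phi>] by blast
qed

lemma mcs_K5:
  assumes ax: "K5 \<Phi> A \<G> \<subseteq> Ax" and V: "mcs V" and lang: "K i \<phi> \<in> Lang" and \<phi>: "K i \<phi> \<notin> V"
  shows "K i (\<^bold>\<not> K i \<phi>) \<in> V"
proof -
  have "\<^bold>\<not> K i \<phi> \<in> V" using mcs_Neg [OF V lang] \<phi> by blast
  moreover have "\<^bold>\<not> K i \<phi> \<^bold>\<longrightarrow> K i (\<^bold>\<not> K i \<phi>) \<in> K5 \<Phi> A \<G>"
    using lang unfolding K5_def by auto
  ultimately show ?thesis using ax mcs_axiom_Imp [OF V] by blast
qed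

lemma mcs_E6:
  assumes ax: "E6 \<Phi> A \<G> \<subseteq> Ax" and V: "mcs V" and lang: "E G \<phi> \<in> Lang" and \<phi>: "\<phi> \<notin> V"
  shows "E G (\<^bold>\<not> E G \<phi>) \<in> V"
proof -
  have "\<^bold>\<not> \<phi> \<in> V" using mcs_Neg [OF V] lang \<phi> by auto
  moreover have "\<^bold>\<not> \<phi> \<^bold>\<longrightarrow> E G (\<^bold>\<not> E G \<phi>) \<in> E6 \<Phi> A \<G>"
    using lang unfolding E6_def by auto
  ultimately show ?thesis using ax mcs_axiom_Imp [OF V] by blast
qed

lemma mcs_E4:
  assumes ax: "E4 \<Phi> A \<G> \<subseteq> Ax" and V: "mcs V" and lang: "E G \<phi> \<in> Lang"
  shows "E G (E G \<phi> \<^bold>\<longrightarrow> \<phi>) \<in> V"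
proof -
  have "E G (E G \<phi> \<^bold>\<longrightarrow> \<phi>) \<in> E4 \<Phi> A \<G>"
    using lang unfolding E4_def by auto
  then show ?thesis using ax theory_axiom [OF mcs_theory [OF V]] by blast
qed

lemma mcs_K3:
  assumes ax: "K3 \<Phi> A \<subseteq> Ax" and V: "mcs V" and "i \<in> A" "p \<in> \<Phi>"
  shows "K i (Fls p) \<notin> V"
proof -
  have "\<^bold>\<not> K i (Fls p) \<in> K3 \<Phi> A"
    using assms unfolding K3_def by blast
  then have "\<^bold>\<not> K i (Fls p) \<in> V" using ax theory_axiom [OF mcs_theory [OF V]] by blast
  moreover have "K i (Fls p) \<in> Lang" using assms by simp
  ultimately show ?thesis using mcs_Neg [OF V] by blast
qed

text \<open>With \<open>K5_step\<close>, sets linked by a canonical edge of \<open>i\<close> have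
  the same \<open>K i\<close> formulas. The filtered relations for S5 and KD45 are built on this
  agreement.\<close>

lemma K4_step:
  assumes "K4 \<Phi> A \<G> \<subseteq> Ax" "mcs V" "\<And>\<chi>. K i \<chi> \<in> V \<Longrightarrow> \<chi> \<in> W" "K i \<phi> \<in> V"
  shows "K i \<phi> \<in> W"
  using mcs_K4 [OF assms(1,2,4)] assms(3) by blast

lemma K5_step:
  assumes "K5 \<Phi> A \<G> \<subseteq> Ax" "mcs V" "mcs W" "\<And>\<chi>. K i \<chi> \<in> V \<Longrightarrow> \<chi> \<in> W" "K i \<phi> \<in> W"
  shows "K i \<phi> \<in> V"
proof (rule ccontr)
  have lang: "K i \<phi> \<in> Lang" using mcs_in_lang assms(3,5) .
  assume "K i \<phi> \<notin> V"
  then have "\<^bold>\<not> K i \<phi> \<in> W" using mcs_K5 [OF assms(1,2) lang] assms(4) by blast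
  then show False using mcs_Neg [OF assms(3) lang] assms(5) by blast
qed

end

section \<open>Relations for each of the five frame classes\<close>

context filtration
begin

lemma F_lang: "\<phi> \<in> F \<Longrightarrow> \<phi> \<in> Lang"
  using F_subset by blast

text \<open>The largest relation with \<open>group_rel T\<close>. Every relation of an unnamed agent
  is carved out of it.\<close>

definition "group_edges T = {(X, Y) \<in> S \<times> S. \<forall>G\<in>T. \<forall>\<chi>. E G \<chi> \<in> F \<longrightarrow> E G \<chi> \<in> X \<longrightarrow> \<chi> \<in> Y}"

lemma group_rel_iff: "group_rel T r \<longleftrightarrow> r \<subseteq> group_edges T"
  unfolding group_rel_def group_edges_def by blast

lemma group_edgesI:
  assumes "rep V X" "rep W Y" "\<And>G \<chi>. G \<in> T \<Longrightarrow> E G \<chi> \<in> F \<Longrightarrow> E G \<chi> \<in> V \<Longrightarrow> \<chi> \<in> W"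
  shows "(X, Y) \<in> group_edges T"
proof -
  have "\<chi> \<in> Y" if "G \<in> T" "E G \<chi> \<in> F" "E G \<chi> \<in> X" for G \<chi>
    using assms(3) [OF that(1,2)] that(3) rep_mem [OF assms(1) that(2)]
      rep_mem [OF assms(2) F_E [OF that(2)]] by blast
  then show ?thesis
    using rep_S [OF assms(1)] rep_S [OF assms(2)] unfolding group_edges_def by blast
qed

lemma sees_edge: "rep V X \<Longrightarrow> rep W Y \<Longrightarrow> sees T V W \<Longrightarrow> (X, Y) \<in> group_edges T"
  by (rule group_edgesI) (auto simp: sees_def)

text \<open>Lets K2 and K3 act on the groups of \<open>i\<close>: this gives loops and successors
  for unnamed agents without corresponding axioms for \<open>E G\<close>.\<close>

lemma memb_E1: "mcs V \<Longrightarrow> G \<in> memb i \<Longrightarrow> E G \<phi> \<in> V \<Longrightarrow> K i \<phi> \<in> V"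
  unfolding memb_def by (blast intro: mcs_E1)

lemma named_relI:
  assumes "r \<subseteq> S \<times> S"
    and "\<And>V W X Y \<chi>. rep V X \<Longrightarrow> rep W Y \<Longrightarrow> (X, Y) \<in> r \<Longrightarrow> K i \<chi> \<in> F \<Longrightarrow> K i \<chi> \<in> X \<Longrightarrow> \<chi> \<in> W"
    and "\<And>V W X Y. rep V X \<Longrightarrow> rep W Y \<Longrightarrow> (\<And>\<chi>. K i \<chi> \<in> V \<Longrightarrow> \<chi> \<in> W) \<Longrightarrow> (X, Y) \<in> r"
  shows "named_rel i r"
  unfolding named_rel_def
proof (intro conjI allI impI)
  fix X Y \<chi> assume *: "(X, Y) \<in> r" "K i \<chi> \<in> F" "K i \<chi> \<in> X"
  then obtain V W where V: "rep V X" and W: "rep W Y" using assms(1) unfolding S_def by blast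
  show "\<chi> \<in> Y" using assms(2) [OF V W *] rep_mem [OF W] F_K [OF *(2)] by blast
qed (use assms(1,3) in blast)+

definition "agent_edges i = {(X, Y) \<in> S \<times> S. \<forall>\<chi>. K i \<chi> \<in> F \<longrightarrow> K i \<chi> \<in> X \<longrightarrow> \<chi> \<in> Y}"

lemma agent_edgesI:
  assumes "rep V X" "rep W Y" "\<And>\<chi>. K i \<chi> \<in> V \<Longrightarrow> \<chi> \<in> W"
  shows "(X, Y) \<in> agent_edges i"
proof -
  have "\<chi> \<in> Y" if "K i \<chi> \<in> F" "K i \<chi> \<in> X" for \<chi>
    using assms(3) [of \<chi>] that(2) rep_mem [OF assms(1) that(1)]
      rep_mem [OF assms(2), of \<chi>] F_K [OF that(1)] by blast
  then show ?thesis
    using rep_S [OF assms(1)] rep_S [OF assms(2)] unfolding agent_edges_def by blast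
qed

lemma named_rel_agent_edges: "named_rel i (agent_edges i)"
proof (rule named_relI)
  fix V W X Y assume "rep V X" "rep W Y" "\<And>\<chi>. K i \<chi> \<in> V \<Longrightarrow> \<chi> \<in> W"
  then show "(X, Y) \<in> agent_edges i" by (rule agent_edgesI)
next
  fix V W X Y \<chi> assume "rep W Y" "(X, Y) \<in> agent_edges i" "K i \<chi> \<in> F" "K i \<chi> \<in> X"
  then show "\<chi> \<in> W" using rep_mem [of W Y \<chi>] F_K unfolding agent_edges_def by blast
qed (auto simp: agent_edges_def)

lemma supportsI:
  assumes named: "\<And>i. i \<in> J \<Longrightarrow> P (n i)" "\<And>i. i \<in> J \<Longrightarrow> named_rel i (n i)"
    and default: "\<And>i. i \<in> A - J \<Longrightarrow> \<exists>r. P r \<and> r \<subseteq> group_edges (memb i)"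
    and edge: "\<And>i V W X. i \<in> A - J \<Longrightarrow> rep V X \<Longrightarrow> mcs W \<Longrightarrow> sees (memb i) V W \<Longrightarrow>
      \<exists>r Y. P r \<and> r \<subseteq> group_edges (memb i) \<and> (X, Y) \<in> r \<and> rep W Y"
  shows "supports P"
  unfolding supports_def group_rel_iff
proof (intro conjI ballI allI impI)
  fix i assume "i \<in> J"
  then show "\<exists>r. P r \<and> named_rel i r" using named by blast
qed (use default edge in simp_all)

lemma supports_K: "supports (\<lambda>r. True)"
proof (rule supportsI)
  fix i V W X assume "rep V X" "mcs W" "sees (memb i) V W"
  then have "(X, W \<inter> F) \<in> group_edges (memb i)" "rep W (W \<inter> F)"
    using sees_edge rep_restrict by blast+
  then show "\<exists>r Y. True \<and> r \<subseteq> group_edges (memb i) \<and> (X, Y) \<in> r \<and> rep W Y" by blast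
qed (use named_rel_agent_edges in blast)+

lemma group_edges_refl:
  assumes "K2 \<Phi> A \<G> \<subseteq> Ax" "X \<in> S"
  shows "(X, X) \<in> group_edges (memb i)"
proof -
  obtain V where V: "rep V X" using assms(2) unfolding S_def by blast
  then show ?thesis
    using memb_E1 mcs_K2 [OF assms(1)] rep_mcs by (intro group_edgesI [of V _ V]) blast+
qed

lemma supports_T:
  assumes ax: "K2 \<Phi> A \<G> \<subseteq> Ax"
  shows "supports (refl_on S)"
proof (rule supportsI)
  show "refl_on S (agent_edges i)" for i
    unfolding refl_on_def
  proof (intro ballI)
    fix X assume "X \<in> S"
    then obtain V where V: "rep V X" unfolding S_def by blast
    show "(X, X) \<in> agent_edges i"
      by (rule agent_edgesI [OF V V mcs_K2 [OF ax rep_mcs [OF V]]])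
  qed
  have refl: "refl_on S (group_edges (memb i))" for i
    using group_edges_refl [OF ax] by (simp add: refl_on_def)
  then show "\<exists>r. refl_on S r \<and> r \<subseteq> group_edges (memb i)" for i by blast
  fix i V W X assume "rep V X" "mcs W" "sees (memb i) V W"
  then have "(X, W \<inter> F) \<in> group_edges (memb i)" "rep W (W \<inter> F)"
    using sees_edge rep_restrict by blast+
  then show "\<exists>r Y. refl_on S r \<and> r \<subseteq> group_edges (memb i) \<and> (X, Y) \<in> r \<and> rep W Y"
    using refl by blast
qed (rule named_rel_agent_edges)

lemma supports_S4:
  assumes ax: "K2 \<Phi> A \<G> \<subseteq> Ax" "K4 \<Phi> A \<G> \<subseteq> Ax"
  shows "supports (\<lambda>r. refl_on S r \<and> trans r)"
proof -
  \<comment> \<open>The filtration suited to transitivity: edges preserve \<open>K i \<chi>\<close>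
    itself, and K2 recovers \<open>\<chi>\<close> at the target.\<close>
  define n where "n i = {(X, Y) \<in> S \<times> S. \<forall>\<chi>. K i \<chi> \<in> F \<longrightarrow> K i \<chi> \<in> X \<longrightarrow> K i \<chi> \<in> Y}" for i
  show ?thesis
  proof (rule supportsI)
    show "refl_on S (n i) \<and> trans (n i)" for i
      unfolding n_def refl_on_def trans_def by blast
    show "named_rel i (n i)" for i
    proof (rule named_relI)
      fix V W X Y \<chi>
      assume *: "rep V X" "rep W Y" "(X, Y) \<in> n i" "K i \<chi> \<in> F" "K i \<chi> \<in> X"
      then have "K i \<chi> \<in> W" using rep_mem [OF *(2,4)] unfolding n_def by blast
      then show "\<chi> \<in> W" using mcs_K2 [OF ax(1) rep_mcs [OF *(2)]] by blast
    next
      fix V W X Y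
      assume *: "rep V X" "rep W Y" "\<And>\<chi>. K i \<chi> \<in> V \<Longrightarrow> \<chi> \<in> W"
      then show "(X, Y) \<in> n i"
        using K4_step [OF ax(2) rep_mcs [OF *(1)] *(3)] rep_mem [OF *(1)] rep_mem [OF *(2)] rep_S
        unfolding n_def by auto
    qed (auto simp: n_def)
    have Id: "Id_on S \<subseteq> group_edges (memb i)" for i
      using group_edges_refl [OF ax(1)] by (auto simp: Id_on_def)
    have "refl_on S (Id_on S) \<and> trans (Id_on S)" by (auto simp: refl_on_def trans_def)
    then show "\<exists>r. (refl_on S r \<and> trans r) \<and> r \<subseteq> group_edges (memb i)" for i using Id by blast
    fix i V W X assume *: "rep V X" "mcs W" "sees (memb i) V W"
    then have "(X, W \<inter> F) \<in> group_edges (memb i)" "rep W (W \<inter> F)"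
      using sees_edge rep_restrict by blast+
    \<comment> \<open>Of two composable edges at least one is a loop, unless the prescribed edge is
      a loop itself, so transitivity is immediate.\<close>
    moreover have "refl_on S (insert (X, W \<inter> F) (Id_on S)) \<and> trans (insert (X, W \<inter> F) (Id_on S))"
      by (auto simp: refl_on_def trans_def)
    ultimately show "\<exists>r Y. (refl_on S r \<and> trans r) \<and> r \<subseteq> group_edges (memb i) \<and> (X, Y) \<in> r \<and> rep W Y"
      using Id [of i] by (intro exI [of _ "insert (X, W \<inter> F) (Id_on S)"] exI [of _ "W \<inter> F"]) simp
  qed
qed

lemma supports_S5:
  assumes ax: "K2 \<Phi> A \<G> \<subseteq> Ax" "K4 \<Phi> A \<G> \<subseteq> Ax" "K5 \<Phi> A \<G> \<subseteq> Ax" "E6 \<Phi> A \<G> \<subseteq> Ax"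
  shows "supports (\<lambda>r. refl_on S r \<and> sym r \<and> trans r)"
proof -
  define n where "n i = {(X, Y) \<in> S \<times> S. \<forall>\<chi>. K i \<chi> \<in> F \<longrightarrow> (K i \<chi> \<in> X \<longleftrightarrow> K i \<chi> \<in> Y)}" for i
  show ?thesis
  proof (rule supportsI)
    show "refl_on S (n i) \<and> sym (n i) \<and> trans (n i)" for i
      unfolding n_def refl_on_def sym_def trans_def by blast
    show "named_rel i (n i)" for i
    proof (rule named_relI)
      fix V W X Y \<chi>
      assume *: "rep V X" "rep W Y" "(X, Y) \<in> n i" "K i \<chi> \<in> F" "K i \<chi> \<in> X"
      then have "K i \<chi> \<in> W" using rep_mem [OF *(2,4)] unfolding n_def by blast
      then show "\<chi> \<in> W" using mcs_K2 [OF ax(1) rep_mcs [OF *(2)]] by blast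
    next
      fix V W X Y
      assume *: "rep V X" "rep W Y" "\<And>\<chi>. K i \<chi> \<in> V \<Longrightarrow> \<chi> \<in> W"
      have "K i \<chi> \<in> V \<longleftrightarrow> K i \<chi> \<in> W" for \<chi>
        using K4_step [OF ax(2) rep_mcs [OF *(1)] *(3), of i \<chi>]
          K5_step [OF ax(3) rep_mcs [OF *(1)] rep_mcs [OF *(2)] *(3), of i \<chi>] by blast
      then show "(X, Y) \<in> n i"
        using rep_mem [OF *(1)] rep_mem [OF *(2)] rep_S *(1,2) unfolding n_def by auto
    qed (auto simp: n_def)
    have Id: "Id_on S \<subseteq> group_edges (memb i)" for i
      using group_edges_refl [OF ax(1)] by (auto simp: Id_on_def)
    have "refl_on S (Id_on S) \<and> sym (Id_on S) \<and> trans (Id_on S)"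
      by (auto simp: refl_on_def sym_def trans_def)
    then show "\<exists>r. (refl_on S r \<and> sym r \<and> trans r) \<and> r \<subseteq> group_edges (memb i)" for i
      using Id by blast
    fix i V W X assume *: "rep V X" "mcs W" "sees (memb i) V W"
    let ?Y = "W \<inter> F"
    have Y: "(X, ?Y) \<in> group_edges (memb i)" "rep W ?Y"
      using * sees_edge rep_restrict by blast+
    \<comment> \<open>If \<open>\<chi>\<close> is not in \<open>V\<close>, E6 puts
      \<open>E G (Neg (E G \<chi>))\<close> into \<open>V\<close>, and \<open>sees\<close> carries
      the negation of \<open>E G \<chi>\<close> to \<open>W\<close>.\<close>
    have "(?Y, X) \<in> group_edges (memb i)"
    proof (rule group_edgesI [OF Y(2) *(1)], rule ccontr)
      fix G \<chi> assume G: "G \<in> memb i" "E G \<chi> \<in> F" "E G \<chi> \<in> W" "\<chi> \<notin> V"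
      then have "\<^bold>\<not> E G \<chi> \<in> W"
        using mcs_E6 [OF ax(4) rep_mcs [OF *(1)] F_lang] *(3) unfolding sees_def by blast
      then show False using mcs_Neg [OF *(2) F_lang] G by blast
    qed
    moreover have "X \<in> S" "?Y \<in> S" using *(1) Y(2) rep_S by blast+
    then have "refl_on S (Id_on S \<union> {(X, ?Y), (?Y, X)}) \<and> sym (Id_on S \<union> {(X, ?Y), (?Y, X)}) \<and>
        trans (Id_on S \<union> {(X, ?Y), (?Y, X)})"
      by (auto simp: refl_on_def sym_def trans_def)
    ultimately show "\<exists>r Y. (refl_on S r \<and> sym r \<and> trans r) \<and> r \<subseteq> group_edges (memb i) \<and> (X, Y) \<in> r \<and> rep W Y"
      using Id [of i] Y by (intro exI [of _ "Id_on S \<union> {(X, ?Y), (?Y, X)}"] exI [of _ ?Y]) simp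
  qed
qed

text \<open>All edges lead into the copy of the states selected by \<open>b\<close>, so that the other copy is free
  to choose its successors \<open>g\<close>.\<close>

lemma kd45_relation:
  assumes g: "\<And>X. X \<in> S \<Longrightarrow> (X, g X) \<in> group_edges T \<and> (g X, g X) \<in> group_edges T \<and> (m \<in> g X \<longleftrightarrow> b)"
  shows "\<exists>r. (euclidean r \<and> serial_on S r \<and> trans r) \<and> r \<subseteq> group_edges T \<and>
    (\<forall>X\<in>S. (m \<in> X \<longleftrightarrow> \<not> b) \<longrightarrow> (X, g X) \<in> r)"
proof -
  \<comment> \<open>\<open>f\<close> is idempotent: \<open>g X\<close> lies in the copy
    \<open>b\<close> and is reflexive, so \<open>f\<close> fixes it. The graph of an idempotent
    self-map of \<open>S\<close> is serial, transitive and Euclidean.\<close>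
  define f where "f X = (if (m \<in> X \<longleftrightarrow> b) \<and> (X, X) \<in> group_edges T then X else g X)" for X
  define r where "r = {(X, f X) | X. X \<in> S}"
  have f: "(X, f X) \<in> group_edges T" "f (f X) = f X" if "X \<in> S" for X
    using g [OF that] by (simp_all add: f_def)
  have f_S: "f X \<in> S" if "X \<in> S" for X
    using f(1) [OF that] unfolding group_edges_def by blast
  have r: "(X, Y) \<in> r \<longleftrightarrow> X \<in> S \<and> Y = f X" for X Y unfolding r_def by blast
  have "euclidean r" "trans r"
    unfolding euclidean_def trans_def r using f(2) f_S by simp_all
  moreover have "serial_on S r" unfolding serial_on_def r using f_S by blast
  moreover have "r \<subseteq> group_edges T" using f(1) unfolding r_def by blast
  moreover have "(X, g X) \<in> r" if "X \<in> S" "m \<in> X \<longleftrightarrow> \<not> b" for X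
    using that unfolding r f_def by simp
  ultimately show ?thesis by blast
qed

lemma rep_level:
  assumes "mcs W"
  obtains Y where "rep W Y" "m \<in> Y \<longleftrightarrow> b"
  by (rule that [of "W \<inter> F \<union> (if b then {m} else {})"]) (use assms marker in \<open>auto simp: rep_def\<close>)

text \<open>K3 says that what \<open>i\<close> knows at \<open>V\<close> omits \<open>Fls p\<close>,
  hence is a proper theory and extends to a maximal consistent set.\<close>

lemma K3_successor:
  assumes ax: "K3 \<Phi> A \<subseteq> Ax" and V: "mcs V" and i: "i \<in> A"
  obtains W where "mcs W" "\<And>\<chi>. K i \<chi> \<in> V \<Longrightarrow> \<chi> \<in> W"
proof -
  obtain \<phi> where "\<phi> \<in> Lang" using F_nonempty F_lang by blast
  then obtain p where p: "p \<in> \<Phi>" using lang_nonempty by blast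
  then have "Fls p \<in> Lang" by simp
  then show thesis
    by (rule K_witness [OF V i _ mcs_K3 [OF ax V i p]]) (rule that)
qed

lemma supports_KD45:
  assumes ax: "K3 \<Phi> A \<subseteq> Ax" "K4 \<Phi> A \<G> \<subseteq> Ax" "K5 \<Phi> A \<G> \<subseteq> Ax" "E4 \<Phi> A \<G> \<subseteq> Ax"
  shows "supports (\<lambda>r. euclidean r \<and> serial_on S r \<and> trans r)"
proof -
  define n where "n i = {(X, Y) \<in> S \<times> S. \<forall>\<chi>. K i \<chi> \<in> F \<longrightarrow>
    (K i \<chi> \<in> X \<longleftrightarrow> K i \<chi> \<in> Y) \<and> (K i \<chi> \<in> X \<longrightarrow> \<chi> \<in> Y)}" for i
  have named: "named_rel i (n i)" for i
  proof (rule named_relI)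
    fix V W X Y \<chi>
    assume *: "rep V X" "rep W Y" "(X, Y) \<in> n i" "K i \<chi> \<in> F" "K i \<chi> \<in> X"
    then have "\<chi> \<in> Y" unfolding n_def by blast
    then show "\<chi> \<in> W" using rep_mem [OF *(2)] F_K [OF *(4)] by blast
  next
    fix V W X Y
    assume *: "rep V X" "rep W Y" "\<And>\<chi>. K i \<chi> \<in> V \<Longrightarrow> \<chi> \<in> W"
    have "K i \<chi> \<in> V \<longleftrightarrow> K i \<chi> \<in> W" for \<chi>
      using K4_step [OF ax(2) rep_mcs [OF *(1)] *(3), of i \<chi>]
        K5_step [OF ax(3) rep_mcs [OF *(1)] rep_mcs [OF *(2)] *(3), of i \<chi>] by blast
    then have "K i \<chi> \<in> X \<longleftrightarrow> K i \<chi> \<in> Y" if "K i \<chi> \<in> F" for \<chi>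
      using rep_mem [OF *(1) that] rep_mem [OF *(2) that] by blast
    then show "(X, Y) \<in> n i"
      using agent_edgesI [OF *] unfolding n_def agent_edges_def by blast
  qed (auto simp: n_def)
  \<comment> \<open>E4 in \<open>V\<close> says that everyone in \<open>G\<close> takes
    \<open>E G \<chi>\<close> to imply \<open>\<chi>\<close>, so this implication holds in every
    \<open>W\<close> seen from \<open>V\<close>.\<close>
  have reflexive: "(Y, Y) \<in> group_edges (memb i)" if V: "mcs V" and W: "rep W Y" "sees (memb i) V W" for i V W Y
  proof (rule group_edgesI [OF W(1) W(1)])
    fix G \<chi> assume G: "G \<in> memb i" "E G \<chi> \<in> F" "E G \<chi> \<in> W"
    then have "E G \<chi> \<^bold>\<longrightarrow> \<chi> \<in> W"
      using mcs_E4 [OF ax(4) V F_lang] W(2) unfolding sees_def by blast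
    then show "\<chi> \<in> W" using mcs_MP [OF rep_mcs [OF W(1)]] G(3) by blast
  qed
  have succ: "\<exists>Y. (X, Y) \<in> group_edges (memb i) \<and> (Y, Y) \<in> group_edges (memb i) \<and> (m \<in> Y \<longleftrightarrow> b)"
    if X: "X \<in> S" and i: "i \<in> A" for i X b
  proof -
    obtain V where V: "rep V X" using X unfolding S_def by blast
    obtain W where W: "mcs W" "\<And>\<chi>. K i \<chi> \<in> V \<Longrightarrow> \<chi> \<in> W"
      using K3_successor [OF ax(1) rep_mcs [OF V] i] by blast
    obtain Y where Y: "rep W Y" "m \<in> Y \<longleftrightarrow> b" using rep_level [OF W(1)] .
    have "sees (memb i) V W"
      using memb_E1 [OF rep_mcs [OF V]] W(2) unfolding sees_def by blast
    then show ?thesis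
      using sees_edge [OF V Y(1)] reflexive [OF rep_mcs [OF V] Y(1)] Y(2) by blast
  qed
  show ?thesis
  proof (rule supportsI)
    fix i assume "i \<in> J"
    then have i: "i \<in> A" using J_subset by blast
    have "\<exists>Y\<in>S. (X, Y) \<in> n i" if X: "X \<in> S" for X
    proof -
      obtain V where V: "rep V X" using X unfolding S_def by blast
      obtain W where W: "mcs W" "\<And>\<chi>. K i \<chi> \<in> V \<Longrightarrow> \<chi> \<in> W"
        using K3_successor [OF ax(1) rep_mcs [OF V] i] by blast
      then have "(X, W \<inter> F) \<in> n i"
        using named [of i] V rep_restrict [OF W(1)] unfolding named_rel_def by blast
      then show ?thesis unfolding n_def by blast
    qed
    moreover have "euclidean (n i)" "trans (n i)"
      unfolding euclidean_def trans_def n_def by blast+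
    ultimately show "euclidean (n i) \<and> serial_on S (n i) \<and> trans (n i)"
      unfolding serial_on_def by blast
    show "named_rel i (n i)" by (rule named)
  next
    fix i assume "i \<in> A - J"
    then have "\<exists>g. \<forall>X\<in>S. (X, g X) \<in> group_edges (memb i) \<and> (g X, g X) \<in> group_edges (memb i) \<and> (m \<in> g X \<longleftrightarrow> True)"
      using succ [of _ i True] by (intro bchoice) blast
    then show "\<exists>r. (euclidean r \<and> serial_on S r \<and> trans r) \<and> r \<subseteq> group_edges (memb i)"
      using kd45_relation [of _ "memb i" True] by blast
  next
    fix i V W X assume i: "i \<in> A - J" and *: "rep V X" "mcs W" "sees (memb i) V W"
    \<comment> \<open>The target goes into the copy to which \<open>X\<close> does not belong. In
      its own copy \<open>X\<close> might be fixed by the relation and unable to point to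
      \<open>Y\<close>.\<close>
    let ?b = "m \<notin> X"
    obtain Y where Y: "rep W Y" "m \<in> Y \<longleftrightarrow> ?b" using rep_level [OF *(2)] .
    have "\<exists>g. \<forall>X\<in>S. (X, g X) \<in> group_edges (memb i) \<and> (g X, g X) \<in> group_edges (memb i) \<and> (m \<in> g X \<longleftrightarrow> ?b)"
      using succ [of _ i ?b] i by (intro bchoice) blast
    then obtain g where g: "\<And>Z. Z \<in> S \<Longrightarrow> (Z, g Z) \<in> group_edges (memb i) \<and>
      (g Z, g Z) \<in> group_edges (memb i) \<and> (m \<in> g Z \<longleftrightarrow> ?b)" by blast
    \<comment> \<open>Only the successor of \<open>X\<close> is redirected; \<open>Y\<close> is a
      legitimate value because it is reflexive by E4 and lies in the selected copy.\<close>
    define h where "h = g(X := Y)"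
    have "(Z, h Z) \<in> group_edges (memb i) \<and> (h Z, h Z) \<in> group_edges (memb i) \<and> (m \<in> h Z \<longleftrightarrow> ?b)"
      if "Z \<in> S" for Z
      using g [OF that] sees_edge [OF *(1) Y(1) *(3)] reflexive [OF rep_mcs [OF *(1)] Y(1) *(3)] Y(2)
      by (simp add: h_def)
    then have "\<exists>r. (euclidean r \<and> serial_on S r \<and> trans r) \<and> r \<subseteq> group_edges (memb i) \<and>
        (\<forall>Z\<in>S. (m \<in> Z \<longleftrightarrow> \<not> ?b) \<longrightarrow> (Z, h Z) \<in> r)"
      by (rule kd45_relation)
    then obtain r where r: "euclidean r \<and> serial_on S r \<and> trans r" "r \<subseteq> group_edges (memb i)"
      and edges: "\<forall>Z\<in>S. (m \<in> Z \<longleftrightarrow> \<not> ?b) \<longrightarrow> (Z, h Z) \<in> r" by (elim exE conjE) (rule that, auto)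
    have "(X, h X) \<in> r" using edges rep_S [OF *(1)] by simp
    then have "(X, Y) \<in> r" by (simp add: h_def)
    then show "\<exists>r Y. (euclidean r \<and> serial_on S r \<and> trans r) \<and> r \<subseteq> group_edges (memb i) \<and> (X, Y) \<in> r \<and> rep W Y"
      using r(1,2) Y(1) by blast
  qed
qed

end

section \<open>Assembling completeness for the five systems\<close>

lemma axiom_system_intro:
  assumes "\<And>G. G \<in> \<G> \<Longrightarrow> G \<subseteq> A \<and> G \<noteq> {}" "Ax \<subseteq> lang \<Phi> A \<G>"
  shows "axiom_system \<Phi> A \<G> (K_axioms \<Phi> A \<G> \<union> Ax)"
proof
  have "E2 \<Phi> A \<G> \<subseteq> lang \<Phi> A \<G>"
  proof
    fix \<psi> assume "\<psi> \<in> E2 \<Phi> A \<G>"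
    then obtain js Gs G \<phi> where \<psi>: "\<psi> = bigconj (map (\<lambda>i. K i \<phi>) js @ map (\<lambda>G'. E G' \<phi>) Gs) \<^bold>\<longrightarrow> E G \<phi>"
      and *: "set js \<subseteq> A" "set Gs \<subseteq> \<G>" "G \<in> \<G>" "G \<subseteq> set js \<union> \<Union> (set Gs)" "\<phi> \<in> lang \<Phi> A \<G>"
      unfolding E2_def by blast
    have "map (\<lambda>i. K i \<phi>) js @ map (\<lambda>G'. E G' \<phi>) Gs \<noteq> []"
      using * assms(1) by fastforce
    then show "\<psi> \<in> lang \<Phi> A \<G>"
      unfolding \<psi> using * by (auto simp: bigconj_in_lang)
  qed
  then show "K_axioms \<Phi> A \<G> \<union> Ax \<subseteq> lang \<Phi> A \<G>"
    using assms unfolding K_axioms_def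
    by (auto simp: Prop_def K1_def E1_def E3_def C1_def)
qed (use assms in auto)

lemma complete_theorems:
  assumes groups: "\<And>G. G \<in> \<G> \<Longrightarrow> G \<subseteq> A \<and> G \<noteq> {}" and Ax: "Ax \<subseteq> lang \<Phi> A \<G>"
    and supports: "\<And>F J m. filtration \<Phi> A \<G> (K_axioms \<Phi> A \<G> \<union> Ax) F J m \<Longrightarrow>
      filtration.supports \<Phi> A \<G> (K_axioms \<Phi> A \<G> \<union> Ax) F J m
        (P (filtration.S \<Phi> A \<G> (K_axioms \<Phi> A \<G> \<union> Ax) F m))"
  shows "complete (lang \<Phi> A \<G>) (theorems A \<G> (K_axioms \<Phi> A \<G> \<union> Ax))
    {M \<in> M_all A. \<forall>i\<in>A. P (states M) (acc M i)}"
proof -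
  have "axiom_system \<Phi> A \<G> (K_axioms \<Phi> A \<G> \<union> Ax)"
    using groups Ax by (rule axiom_system_intro)
  then show ?thesis using supports by (rule axiom_system.completeness)
qed

context
  fixes \<Phi> :: "'p set" and A :: "'a set" and \<G> :: "'a set set"
  assumes groups: "\<And>G. G \<in> \<G> \<Longrightarrow> G \<subseteq> A \<and> G \<noteq> {}"
begin

lemma complete_K: "complete (lang \<Phi> A \<G>) (K_sys \<Phi> A \<G>)
  (M_all A :: (('p, 'a) fm_state, 'p, 'a) kripke set)"
proof -
  have "complete (lang \<Phi> A \<G>) (theorems A \<G> (K_axioms \<Phi> A \<G> \<union> {})) 
      {M \<in> M_all A :: (('p, 'a) fm_state, 'p, 'a) kripke set. \<forall>i\<in>A. True}"
    by (rule complete_theorems [OF groups]; (rule filtration.supports_K)?) auto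
  then show ?thesis by (simp add: K_sys_def)
qed

lemma complete_T: "complete (lang \<Phi> A \<G>) (T_sys \<Phi> A \<G>)
  (M_r A :: (('p, 'a) fm_state, 'p, 'a) kripke set)"
  unfolding T_sys_def M_r_def
  by (rule complete_theorems [OF groups]; (rule filtration.supports_T)?) (auto simp: K2_def)

lemma complete_S4: "complete (lang \<Phi> A \<G>) (S4_sys \<Phi> A \<G>)
  (M_rt A :: (('p, 'a) fm_state, 'p, 'a) kripke set)"
  unfolding S4_sys_def M_rt_def Un_assoc
  by (rule complete_theorems [OF groups]; (rule filtration.supports_S4)?) (auto simp: K2_def K4_def)

lemma complete_S5: "complete (lang \<Phi> A \<G>) (S5_sys \<Phi> A \<G>)
  (M_rst A :: (('p, 'a) fm_state, 'p, 'a) kripke set)"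
  unfolding S5_sys_def M_rst_def Un_assoc
  by (rule complete_theorems [OF groups]; (rule filtration.supports_S5)?)
    (auto simp: K2_def K4_def K5_def E6_def)

lemma complete_KD45: "complete (lang \<Phi> A \<G>) (KD45_sys \<Phi> A \<G>)
  (M_elt A :: (('p, 'a) fm_state, 'p, 'a) kripke set)"
  unfolding KD45_sys_def M_elt_def Un_assoc
  by (rule complete_theorems [OF groups]; (rule filtration.supports_KD45)?)
    (auto simp: K3_def K4_def K5_def E4_def)

end

theorem theorem3p1:
  fixes \<Phi> :: "'p set" and A :: "'a set" and \<G> :: "'a set set"
  assumes groups: "\<And>G. G \<in> \<G> \<Longrightarrow> G \<subseteq> A \<and> G \<noteq> {}"
  shows "
     (sound (lang \<Phi> A \<G>) (K_sys \<Phi> A \<G>) (M_all A :: ('s, 'p, 'a) kripke set) \<and>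
      complete (lang \<Phi> A \<G>) (K_sys \<Phi> A \<G>) (M_all A :: (('p, 'a) fm_state, 'p, 'a) kripke set)) \<and>
     (sound (lang \<Phi> A \<G>) (T_sys \<Phi> A \<G>) (M_r A :: ('s, 'p, 'a) kripke set) \<and>
      complete (lang \<Phi> A \<G>) (T_sys \<Phi> A \<G>) (M_r A :: (('p, 'a) fm_state, 'p, 'a) kripke set)) \<and>
     (sound (lang \<Phi> A \<G>) (S4_sys \<Phi> A \<G>) (M_rt A :: ('s, 'p, 'a) kripke set) \<and>
      complete (lang \<Phi> A \<G>) (S4_sys \<Phi> A \<G>) (M_rt A :: (('p, 'a) fm_state, 'p, 'a) kripke set)) \<and>
     (sound (lang \<Phi> A \<G>) (S5_sys \<Phi> A \<G>) (M_rst A :: ('s, 'p, 'a) kripke set) \<and>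
      complete (lang \<Phi> A \<G>) (S5_sys \<Phi> A \<G>) (M_rst A :: (('p, 'a) fm_state, 'p, 'a) kripke set)) \<and>
     (sound (lang \<Phi> A \<G>) (KD45_sys \<Phi> A \<G>) (M_elt A :: ('s, 'p, 'a) kripke set) \<and>
      complete (lang \<Phi> A \<G>) (KD45_sys \<Phi> A \<G>) (M_elt A :: (('p, 'a) fm_state, 'p, 'a) kripke set))"
proof (intro conjI)
qed (rule sound_K complete_K sound_T complete_T sound_S4 complete_S4
    sound_S5 complete_S5 sound_KD45 complete_KD45; erule groups)+

end
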